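(* Let $\mathcal{A}$ be a coefficient-free cluster algebra of finite type with initial labeled seed $\Sigma=(\mathbf{x},B)$, $\mathbf{x}=(x_1,\dots,x_n)$, where $n>1$, $B$ is indecomposable and bipartite with sign function $\varepsilon$, and the Cartan counterpart $A(B)$ is a Cartan matrix of finite type. Let $\Phi_{\geq -1}$ be the set of almost positive roots of $A(B)$, let $\alpha\mapsto x_\alpha$ be the bijection from $\Phi_{\geq -1}$ to the set of cluster variables of $\mathcal{A}$, and let $\tau_+,\tau_-$ be the piecewise-linear transformations of $\Phi_{\geq -1}$. Then each of $\tau_+$ and $\tau_-$ induces an inverse cluster automorphism of $\mathcal{A}$. That is, for each sign $\pm$, the assignment $f_\pm: x_\alpha\mapsto x_{\tau_\pm(\alpha)}$ ($\alpha\in\Phi_{\geq -1}$) induces an algebra homomorphism $f_\pm$ of $\mathcal{A}$ which is a cluster automorphism and such that $f_\pm(\mathbf{x})=(f_\pm(x_1),\dots,f_\pm(x_n))$ is a cluster of $\mathcal{A}$ whose exchange matrix, with rows and columns in this order, is $B(f_\pm(\mathbf{x}))=-B$.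
   Context: **Cluster algebras (coefficient-free).** A labeled seed is a pair $(\mathbf{x},B)$ with $\mathbf{x}=(x_1,\dots,x_n)$ a free generating set of the field $\mathbb{Q}(x_1,\dots,x_n)$ (the cluster) and $B=(b_{ji})$ an $n\times n$ integer skew-symmetrizable matrix (the exchange matrix). Mutation $\mu_k$ replaces $x_k$ by $x_k'$ with $x_kx_k'=\prod_{b_{jk}>0}x_j^{b_{jk}}+\prod_{b_{jk}<0}x_j^{-b_{jk}}$, keeps the other variables, and replaces $B$ by $(b'_{ji})$ with $b'_{ji}=-b_{ji}$ if $i=k$ or $j=k$, and $b'_{ji}=b_{ji}+\frac12(|b_{ji}|b_{ik}+b_{ji}|b_{ik}|)$ otherwise... more precisely, $b'_{ji}=b_{ji}+\frac12(|b_{jk}|b_{ki}+b_{jk}|b_{ki}|)$ otherwise. Seeds are labeled seeds up to simultaneous relabeling. The cluster algebra $\mathcal{A}$ is the $\mathbb{Z}$-subalgebra of $\mathbb{Q}(x_1,\dots,x_n)$ generated by all cluster variables in all seeds obtained from the initial one by iterated mutations. It is of finite type if there are finitely many seeds. In finite type a cluster determines its seed; for an ordered cluster $\mathbf{x}'$ of $\mathcal A$, $B(\mathbf{x}')$ denotes its exchange matrix. **Cluster automorphisms.** A $\mathbb{Z}$-algebra automorphism $f:\mathcal{A}\to\mathcal{A}$ is a cluster automorphism if there is a labeled seed $(\mathbf{x}',B')$ of $\mathcal{A}$ such that $f(\mathbf{x}')$ is a cluster and, for every $x,y\in\mathbf{x}'$, $f(\mu_{x,\mathbf{x}'}(y))=\mu_{f(x),f(\mathbf{x}')}(f(y))$,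 where $\mu_{x,\mathbf{x}'}(y)$ is the element replacing $y$ when the seed with cluster $\mathbf{x}'$ is mutated at $x$ (so it equals $y$ if $y\ne x$). A cluster automorphism satisfies $B(f(\mathbf{x}'))=\pm B'$; it is called direct if the sign is $+$ and inverse if it is $-$. **Bipartite.** $B=(b_{ji})$ is bipartite if there is $\varepsilon:\{1,\dots,n\}\to\{1,-1\}$ such that $b_{ji}>0$ implies $\varepsilon(j)=1$ and $\varepsilon(i)=-1$. The Cartan counterpart $A(B)=(a_{ij})$ is given by $a_{ii}=2$ and $a_{ij}=-|b_{ij}|$ for $i\neq j$. **Almost positive roots.** With simple roots $\alpha_1,\dots,\alpha_n$ of $A(B)$ and simple reflections $s_i(\alpha_j)=\alpha_j-a_{ij}\alpha_i$, $\Phi_{\geq -1}$ is the set of positive roots together with the negative simple roots. Write $\alpha=\sum_j[\alpha:\alpha_j]\alpha_j$ and $[c]_+=\max(c,0)$. There is a bijection (Fomin–Zelevinsky) $\alpha\mapsto x_\alpha$ from $\Phi_{\geq -1}$ to the cluster variables of $\mathcal{A}$: $x_{-\alpha_i}=x_i$, and for $\alpha$ positive $x_\alpha$ is the cluster variable of the form $P_\alpha(\mathbf{x})/\prod_j x_j^{[\alpha:\alpha_j]}$ with $P_\alpha$ a polynomial with nonzero constant term. **Piecewise-linear transformations.** For $\epsilon\in\{+,-\}$, $\tau_\epsilon$ is the permutation of $\Phi_{\geq -1}$ with $[\tau_\epsilon(\alpha):\alpha_i]=[\alpha:\alpha_i]$ if $\varepsilon(i)\ne\epsilon$, and $[\tau_\epsilon(\alpha):\alpha_i]=-[\alpha:\alpha_i]-\sum_{j\ne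 i}a_{ij}[\alpha:\alpha_j]_+$ if $\varepsilon(i)=\epsilon$. (Equivalently $\tau_\epsilon=\prod_{\varepsilon(i)=\epsilon}\sigma_i$, where $\sigma_i(\alpha)=\alpha$ if $\alpha=-\alpha_j\neq-\alpha_i$, and $\sigma_i(\alpha)=s_i(\alpha)$ otherwise.) *)

theory Defs
  imports Complex_Main "HOL-Library.Poly_Mapping" "HOL-Analysis.Finite_Cartesian_Product"
begin

section \<open>Labeled seeds and mutation\<close>

text \<open>The index set \<open>{1, ..., n}\<close> is a finite type \<open>'n\<close>. Polynomials in the variables
  indexed by \<open>'n\<close> have type \<open>('n \<Rightarrow>\<^sub>0 nat) \<Rightarrow>\<^sub>0 'c\<close>; the argument \<open>c\<close> below is the
  embedding of the coefficient ring into \<open>'a\<close>.\<close>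

definition poly_eval ::
  "('c::zero \<Rightarrow> 'a::comm_ring_1) \<Rightarrow> ('n::finite \<Rightarrow> 'a) \<Rightarrow> (('n \<Rightarrow>\<^sub>0 nat) \<Rightarrow>\<^sub>0 'c) \<Rightarrow> 'a" where
  "poly_eval c x p =
     (\<Sum>m\<in>Poly_Mapping.keys p. c (Poly_Mapping.lookup p m) * (\<Prod>i\<in>UNIV. x i ^ Poly_Mapping.lookup m i))"

text \<open>The ambient field \<open>\<rat>(x\<^sub>1, ..., x\<^sub>n)\<close> is represented by a field type \<open>'f\<close> that has a
  free generating set indexed by \<open>'n\<close>: a tuple that is algebraically independent over the
  rationals and generates the whole of \<open>'f\<close> as a field.\<close>

definition free_generating :: "('n::finite \<Rightarrow> 'f::field_char_0) \<Rightarrow> bool" where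
  "free_generating x \<longleftrightarrow>
     (\<forall>p. poly_eval of_rat x p = 0 \<longrightarrow> p = 0) \<and>
     (\<forall>z. \<exists>p q. poly_eval of_rat x q \<noteq> 0 \<and> z = poly_eval of_rat x p / poly_eval of_rat x q)"

definition skew_symmetrizable :: "int^'n^'n \<Rightarrow> bool" where
  "skew_symmetrizable B \<longleftrightarrow>
     (\<exists>d :: 'n \<Rightarrow> int. (\<forall>i. d i > 0) \<and> (\<forall>i j. d i * B $ i $ j = - (d j * B $ j $ i)))"

type_synonym ('n, 'f) seed = "('n \<Rightarrow> 'f) \<times> (int^'n^'n)"

definition labeled_seed :: "('n::finite, 'f::field_char_0) seed \<Rightarrow> bool" where
  "labeled_seed s \<longleftrightarrow> free_generating (fst s) \<and> skew_symmetrizable (snd s)"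

definition matrix_mutation :: "'n::finite \<Rightarrow> int^'n^'n \<Rightarrow> int^'n^'n" where
  "matrix_mutation k B = (\<chi> j i. if i = k \<or> j = k then - (B $ j $ i)
     else B $ j $ i + (\<bar>B $ j $ k\<bar> * B $ k $ i + B $ j $ k * \<bar>B $ k $ i\<bar>) div 2)"

definition exchanged_variable :: "'n::finite \<Rightarrow> ('n, 'f::field_char_0) seed \<Rightarrow> 'f" where
  "exchanged_variable k s = (case s of (x, B) \<Rightarrow>
     ((\<Prod>j | B $ j $ k > 0. x j ^ nat (B $ j $ k)) +
      (\<Prod>j | B $ j $ k < 0. x j ^ nat (- (B $ j $ k)))) / x k)"

definition mutation :: "'n::finite \<Rightarrow> ('n, 'f::field_char_0) seed \<Rightarrow> ('n, 'f) seed" where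
  "mutation k s = ((fst s)(k := exchanged_variable k s), matrix_mutation k (snd s))"

inductive_set mutation_class :: "('n::finite, 'f::field_char_0) seed \<Rightarrow> ('n, 'f) seed set"
  for \<Sigma> where
  initial: "\<Sigma> \<in> mutation_class \<Sigma>"
| mutate: "s \<in> mutation_class \<Sigma> \<Longrightarrow> mutation k s \<in> mutation_class \<Sigma>"

definition relabel :: "('n::finite \<Rightarrow> 'n) \<Rightarrow> ('n, 'f) seed \<Rightarrow> ('n, 'f) seed" where
  "relabel \<sigma> s = (fst s \<circ> \<sigma>, \<chi> j i. snd s $ \<sigma> j $ \<sigma> i)"

text \<open>A seed is a class of labeled seeds under simultaneous relabeling.\<close>

definition seed_class :: "('n::finite, 'f) seed \<Rightarrow> ('n, 'f) seed set" where
  "seed_class s = {relabel \<sigma> s | \<sigma>. bij \<sigma>}"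

definition seeds :: "('n::finite, 'f::field_char_0) seed \<Rightarrow> ('n, 'f) seed set set" where
  "seeds \<Sigma> = seed_class ` mutation_class \<Sigma>"

definition labeled_seeds :: "('n::finite, 'f::field_char_0) seed \<Rightarrow> ('n, 'f) seed set" where
  "labeled_seeds \<Sigma> = \<Union> (seeds \<Sigma>)"

definition ordered_clusters :: "('n::finite, 'f::field_char_0) seed \<Rightarrow> ('n \<Rightarrow> 'f) set" where
  "ordered_clusters \<Sigma> = fst ` labeled_seeds \<Sigma>"

definition cluster_variables :: "('n::finite, 'f::field_char_0) seed \<Rightarrow> 'f set" where
  "cluster_variables \<Sigma> = (\<Union>y\<in>ordered_clusters \<Sigma>. range y)"

definition finite_type :: "('n::finite, 'f::field_char_0) seed \<Rightarrow> bool" where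
  "finite_type \<Sigma> \<longleftrightarrow> finite (seeds \<Sigma>)"


section \<open>The cluster algebra and its automorphisms\<close>

inductive_set Z_subalgebra :: "'a::comm_ring_1 set \<Rightarrow> 'a set" for G where
  gen: "g \<in> G \<Longrightarrow> g \<in> Z_subalgebra G"
| one: "1 \<in> Z_subalgebra G"
| diff: "a \<in> Z_subalgebra G \<Longrightarrow> b \<in> Z_subalgebra G \<Longrightarrow> a - b \<in> Z_subalgebra G"
| mult: "a \<in> Z_subalgebra G \<Longrightarrow> b \<in> Z_subalgebra G \<Longrightarrow> a * b \<in> Z_subalgebra G"

definition cluster_algebra :: "('n::finite, 'f::field_char_0) seed \<Rightarrow> 'f set" where
  "cluster_algebra \<Sigma> = Z_subalgebra (cluster_variables \<Sigma>)"

text \<open>Homomorphisms of the cluster algebra are functions on the ambient field of which only the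
  values on the algebra matter.\<close>

definition Z_algebra_automorphism :: "'a::comm_ring_1 set \<Rightarrow> ('a \<Rightarrow> 'a) \<Rightarrow> bool" where
  "Z_algebra_automorphism A f \<longleftrightarrow> bij_betw f A A \<and> f 1 = 1 \<and>
     (\<forall>a\<in>A. \<forall>b\<in>A. f (a + b) = f a + f b \<and> f (a * b) = f a * f b)"

text \<open>The matrix \<open>B(y)\<close> of an ordered cluster \<open>y\<close>. It is well defined whenever a cluster
  determines its seed, as is the case in finite type.\<close>

definition exchange_matrix ::
  "('n::finite, 'f::field_char_0) seed \<Rightarrow> ('n \<Rightarrow> 'f) \<Rightarrow> int^'n^'n" where
  "exchange_matrix \<Sigma> y = (THE C. (y, C) \<in> labeled_seeds \<Sigma>)"

text \<open>\<open>cluster_mutation \<Sigma> y k i\<close> is \<open>\<mu>\<^bsub>u, y\<^esub>(v)\<close> for the members \<open>u = y k\<close> and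
  \<open>v = y i\<close> of the cluster \<open>y\<close>.\<close>

definition cluster_mutation ::
  "('n::finite, 'f::field_char_0) seed \<Rightarrow> ('n \<Rightarrow> 'f) \<Rightarrow> 'n \<Rightarrow> 'n \<Rightarrow> 'f" where
  "cluster_mutation \<Sigma> y k i = fst (mutation k (y, exchange_matrix \<Sigma> y)) i"

definition mutation_compatible ::
  "('n::finite, 'f::field_char_0) seed \<Rightarrow> ('f \<Rightarrow> 'f) \<Rightarrow> ('n \<Rightarrow> 'f) \<Rightarrow> bool" where
  "mutation_compatible \<Sigma> f y \<longleftrightarrow> f \<circ> y \<in> ordered_clusters \<Sigma> \<and>
     (\<forall>k i. f (cluster_mutation \<Sigma> y k i) = cluster_mutation \<Sigma> (f \<circ> y) k i)"

definition cluster_automorphism ::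
  "('n::finite, 'f::field_char_0) seed \<Rightarrow> ('f \<Rightarrow> 'f) \<Rightarrow> bool" where
  "cluster_automorphism \<Sigma> f \<longleftrightarrow> Z_algebra_automorphism (cluster_algebra \<Sigma>) f \<and>
     (\<exists>(y, C) \<in> labeled_seeds \<Sigma>. mutation_compatible \<Sigma> f y)"

definition inverse_cluster_automorphism ::
  "('n::finite, 'f::field_char_0) seed \<Rightarrow> ('f \<Rightarrow> 'f) \<Rightarrow> bool" where
  "inverse_cluster_automorphism \<Sigma> f \<longleftrightarrow> Z_algebra_automorphism (cluster_algebra \<Sigma>) f \<and>
     (\<exists>(y, C) \<in> labeled_seeds \<Sigma>. mutation_compatible \<Sigma> f y \<and> exchange_matrix \<Sigma> (f \<circ> y) = - C)"


section \<open>Bipartite matrices and Cartan matrices\<close>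

definition indecomposable :: "int^'n^'n \<Rightarrow> bool" where
  "indecomposable B \<longleftrightarrow>
     \<not> (\<exists>S. S \<noteq> {} \<and> S \<noteq> UNIV \<and> (\<forall>i\<in>S. \<forall>j\<in>-S. B $ i $ j = 0 \<and> B $ j $ i = 0))"

definition bipartite_with :: "('n \<Rightarrow> int) \<Rightarrow> int^'n^'n \<Rightarrow> bool" where
  "bipartite_with \<epsilon> B \<longleftrightarrow> (\<forall>i. \<epsilon> i \<in> {1, -1}) \<and>
     (\<forall>i j. B $ j $ i > 0 \<longrightarrow> \<epsilon> j = 1 \<and> \<epsilon> i = -1)"

definition cartan_counterpart :: "int^'n::finite^'n \<Rightarrow> int^'n^'n" where
  "cartan_counterpart B = (\<chi> i j. if i = j then 2 else - \<bar>B $ i $ j\<bar>)"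

text \<open>A Cartan matrix of finite type is a generalized Cartan matrix that is symmetrizable with
  positive definite symmetrization.\<close>

definition cartan_matrix_of_finite_type :: "int^'n::finite^'n \<Rightarrow> bool" where
  "cartan_matrix_of_finite_type A \<longleftrightarrow>
     (\<forall>i. A $ i $ i = 2) \<and> (\<forall>i j. i \<noteq> j \<longrightarrow> A $ i $ j \<le> 0) \<and>
     (\<forall>i j. A $ i $ j = 0 \<longleftrightarrow> A $ j $ i = 0) \<and>
     (\<exists>d :: 'n \<Rightarrow> int. (\<forall>i. d i > 0) \<and> (\<forall>i j. d i * A $ i $ j = d j * A $ j $ i) \<and>
        (\<forall>v :: real^'n. v \<noteq> 0 \<longrightarrow>
           (\<Sum>i\<in>UNIV. \<Sum>j\<in>UNIV. of_int (d i * A $ i $ j) * v $ i * v $ j) > 0))"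


section \<open>Almost positive roots\<close>

text \<open>A vector \<open>\<alpha>\<close> in the root lattice is given by its coordinates
  \<open>\<alpha> $ j = [\<alpha> : \<alpha>\<^sub>j]\<close>.\<close>

definition simple_root :: "'n::finite \<Rightarrow> int^'n" where
  "simple_root i = axis i 1"

text \<open>The linear extension of \<open>s\<^sub>i(\<alpha>\<^sub>j) = \<alpha>\<^sub>j - a\<^sub>i\<^sub>j \<alpha>\<^sub>i\<close>.\<close>

definition simple_reflection :: "int^'n::finite^'n \<Rightarrow> 'n \<Rightarrow> int^'n \<Rightarrow> int^'n" where
  "simple_reflection A i \<alpha> =
     (\<chi> j. \<alpha> $ j - (\<Sum>l\<in>UNIV. \<alpha> $ l * A $ i $ l) * simple_root i $ j)"

text \<open>The orbit of the simple roots under the Weyl group; in finite type every root is of this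
  form.\<close>

inductive_set roots :: "int^'n::finite^'n \<Rightarrow> (int^'n) set" for A where
  simple: "simple_root i \<in> roots A"
| reflect: "\<alpha> \<in> roots A \<Longrightarrow> simple_reflection A i \<alpha> \<in> roots A"

definition positive_roots :: "int^'n::finite^'n \<Rightarrow> (int^'n) set" where
  "positive_roots A = {\<alpha> \<in> roots A. \<forall>j. \<alpha> $ j \<ge> 0}"

definition almost_positive_roots :: "int^'n::finite^'n \<Rightarrow> (int^'n) set" where
  "almost_positive_roots A = positive_roots A \<union> range (\<lambda>i. - simple_root i)"

text \<open>\<open>X\<close> is the Fomin--Zelevinsky bijection \<open>\<alpha> \<mapsto> x\<^sub>\<alpha>\<close> from almost positive roots to
  cluster variables. The listed conditions determine \<open>X\<close> on the almost positive roots.\<close>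

definition denominator_bijection ::
  "('n::finite, 'f::field_char_0) seed \<Rightarrow> (int^'n \<Rightarrow> 'f) \<Rightarrow> bool" where
  "denominator_bijection \<Sigma> X \<longleftrightarrow> (case \<Sigma> of (x, B) \<Rightarrow>
     bij_betw X (almost_positive_roots (cartan_counterpart B)) (cluster_variables \<Sigma>) \<and>
     (\<forall>i. X (- simple_root i) = x i) \<and>
     (\<forall>\<alpha> \<in> positive_roots (cartan_counterpart B).
        \<exists>P :: ('n \<Rightarrow>\<^sub>0 nat) \<Rightarrow>\<^sub>0 int. Poly_Mapping.lookup P 0 \<noteq> 0 \<and>
          X \<alpha> = poly_eval of_int x P / (\<Prod>j\<in>UNIV. x j ^ nat (\<alpha> $ j))))"

text \<open>The transformation \<open>\<tau>\<^sub>+\<close> is the case \<open>s = 1\<close> and \<open>\<tau>\<^sub>-\<close> is the case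
  \<open>s = -1\<close>.\<close>

definition tau :: "int^'n::finite^'n \<Rightarrow> ('n \<Rightarrow> int) \<Rightarrow> int \<Rightarrow> int^'n \<Rightarrow> int^'n" where
  "tau A \<epsilon> s \<alpha> = (\<chi> i. if \<epsilon> i = s
     then - (\<alpha> $ i) - (\<Sum>j\<in>UNIV - {i}. A $ i $ j * max (\<alpha> $ j) 0) else \<alpha> $ i)"

end

theory Submission
  imports Defs "HOL-Computational_Algebra.Primes"
begin

text \<open>
  For a sign \<open>t\<close> let \<open>x'\<close> be the cluster obtained from \<open>x\<close> by mutating at all vertices of sign \<open>t\<close>.
  As \<open>B\<close> is bipartite, these mutations commute, they turn \<open>B\<close> into \<open>-B\<close>, and at the vertices of
  sign \<open>t\<close> they give \<open>x'\<^sub>i = (1 + M\<^sub>i) / x\<^sub>i\<close> with a monomial \<open>M\<^sub>i\<close> in the variables of the other sign.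
  The substitution \<open>x \<mapsto> x'\<close> is an involutive automorphism of the ambient field, the flip at \<open>t\<close>.
  Exchange relations are insensitive to the sign of the matrix, so the flip carries seeds to seeds
  while negating their matrices
  (\<open>flip_labeled_seeds\<close>), and it restricts to an automorphism of the cluster algebra. Three things
  remain.

  Denominators are computed by a monomial valuation. Order Laurent monomials by generic positive
  weights and take the exponent of the lowest term of numerator minus that of the denominator.
  On subtraction-free elements, such as cluster variables, this initial exponent turns sums into
  minima. Since \<open>x\<^sub>\<alpha>\<close> has a numerator with nonzero constant term, its initial exponent is \<open>-\<alpha>\<close>, so a
  cluster variable is recognised by its initial exponent (\<open>cluster_variable_of_exponent\<close>).

  The initial cluster determines its matrix (\<open>matrix_of_initial_cluster\<close>). Mutation preserves the
  logarithmic two-form of a seed, and so does its tropical version on initial exponents. For a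
  seed \<open>(x, C)\<close> this says that \<open>C\<close> and \<open>B\<close> have entries of the same sign. Hence the
  variable that \<open>C\<close> exchanges for \<open>x\<^sub>k\<close> has initial exponent \<open>-\<alpha>\<^sub>k\<close>; the same is true of \<open>B\<close>, so the two
  exchange relations at \<open>k\<close> coincide and \<open>C = B\<close>.

  The flip at \<open>t\<close> acts on the \<open>x\<^sub>\<alpha>\<close> as the piecewise-linear map acts on the \<open>\<alpha>\<close>
  (\<open>flip_denominator_bijection\<close>). Start from \<open>-\<alpha>\<^sub>k\<close> and apply the two
  halves of the bipartite Coxeter element alternately. These chains satisfy a linear recurrence
  that is the tropical form of the exchange relations along the bipartite belt, so as long as the
  chains stay nonnegative, alternating products of flips applied to \<open>x\<^sub>k\<close> yield the cluster variables of
  the roots in the chain at \<open>k\<close> (\<open>initial_exponent_flips\<close>). By connectedness all chains leave the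
  nonnegative cone at the same step (\<open>chain_height\<close>), and every positive root lies on a chain, in
  the direction of either sign, because a Coxeter element fixes no nonzero vector
  (\<open>positive_root_in_chain\<close>). One more flip then advances the chain by one step, and on nonnegative
  vectors such a step is the piecewise-linear map.
\<close>


section \<open>Evaluating polynomials in field elements\<close>

definition monomial_value :: "('n::finite \<Rightarrow> 'a::comm_ring_1) \<Rightarrow> ('n \<Rightarrow>\<^sub>0 nat) \<Rightarrow> 'a" where
  "monomial_value x m = (\<Prod>i\<in>UNIV. x i ^ Poly_Mapping.lookup m i)"

abbreviation rat_eval ::
  "('n::finite \<Rightarrow> 'a::field_char_0) \<Rightarrow> (('n \<Rightarrow>\<^sub>0 nat) \<Rightarrow>\<^sub>0 rat) \<Rightarrow> 'a" where
  "rat_eval \<equiv> poly_eval of_rat"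

lemma monomial_value_0: "monomial_value x 0 = 1"
  by (simp add: monomial_value_def)

lemma monomial_value_add: "monomial_value x (m + m') = monomial_value x m * monomial_value x m'"
  by (simp add: monomial_value_def lookup_add power_add prod.distrib)

lemma rat_eval_superset:
  assumes "finite S" and "Poly_Mapping.keys p \<subseteq> S"
  shows "rat_eval x p = (\<Sum>m\<in>S. of_rat (Poly_Mapping.lookup p m) * monomial_value x m)"
  unfolding poly_eval_def monomial_value_def
  by (rule sum.mono_neutral_left) (use assms in \<open>auto simp: in_keys_iff\<close>)

lemma rat_eval_add: "rat_eval x (p + q) = rat_eval x p + rat_eval x q"
proof -
  let ?S = "Poly_Mapping.keys p \<union> Poly_Mapping.keys q"
  have "Poly_Mapping.keys (p + q) \<subseteq> ?S" by (rule Poly_Mapping.keys_add)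
  then show ?thesis
    by (simp add: rat_eval_superset[of ?S] lookup_add of_rat_add distrib_right sum.distrib)
qed

lemma rat_eval_0: "rat_eval x 0 = 0"
  by (simp add: poly_eval_def)

lemma rat_eval_uminus: "rat_eval x (- p) = - rat_eval x p"
  using rat_eval_add[of x p "- p"] by (simp add: rat_eval_0 eq_neg_iff_add_eq_0 add.commute)

lemma rat_eval_diff: "rat_eval x (p - q) = rat_eval x p - rat_eval x q"
  using rat_eval_add[of x p "- q"] by (simp add: rat_eval_uminus)

lemma rat_eval_sum: "rat_eval x (\<Sum>a\<in>S. f a) = (\<Sum>a\<in>S. rat_eval x (f a))"
  by (induction S rule: infinite_finite_induct) (simp_all add: rat_eval_0 rat_eval_add)

lemma rat_eval_single: "rat_eval x (Poly_Mapping.single m c) = of_rat c * monomial_value x m"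
  by (simp add: rat_eval_superset[of "{m}"])

lemma poly_mapping_sum_singles:
  "p = (\<Sum>m\<in>Poly_Mapping.keys p. Poly_Mapping.single m (Poly_Mapping.lookup p m))"
  by (rule poly_mapping_eqI)
    (simp add: lookup_sum lookup_single when_def in_keys_iff)

lemma mult_sum_singles:
  fixes p q :: "'m::monoid_add \<Rightarrow>\<^sub>0 'c::semiring_0"
  shows "p * q = (\<Sum>m\<in>Poly_Mapping.keys p. \<Sum>m'\<in>Poly_Mapping.keys q.
    Poly_Mapping.single (m + m') (Poly_Mapping.lookup p m * Poly_Mapping.lookup q m'))"
proof -
  let ?s = "\<lambda>r m. Poly_Mapping.single m (Poly_Mapping.lookup r m)"
  have "p * q = (\<Sum>m\<in>Poly_Mapping.keys p. ?s p m) * (\<Sum>m\<in>Poly_Mapping.keys q. ?s q m)"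
    using poly_mapping_sum_singles[of p] poly_mapping_sum_singles[of q] by simp
  then show ?thesis
    by (simp add: sum_product mult_single)
qed

lemma rat_eval_mult: "rat_eval x (p * q) = rat_eval x p * rat_eval x q"
proof -
  have "rat_eval x (p * q) = (\<Sum>m\<in>Poly_Mapping.keys p. \<Sum>m'\<in>Poly_Mapping.keys q.
      of_rat (Poly_Mapping.lookup p m * Poly_Mapping.lookup q m') * monomial_value x (m + m'))"
    by (subst mult_sum_singles) (simp add: rat_eval_sum rat_eval_single)
  also have "\<dots> = rat_eval x p * rat_eval x q"
    by (simp add: rat_eval_superset[of "Poly_Mapping.keys p"] rat_eval_superset[of "Poly_Mapping.keys q"]
        sum_product monomial_value_add of_rat_mult mult_ac)
  finally show ?thesis .
qed

lemma rat_eval_const: "rat_eval x (Poly_Mapping.single 0 c) = of_rat c"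
  by (simp add: rat_eval_single monomial_value_def)

lemma rat_eval_1: "rat_eval x 1 = 1"
  using rat_eval_const[of x 1] by simp

lemma monomial_value_single: "monomial_value x (Poly_Mapping.single i 1) = x i"
proof -
  have "monomial_value x (Poly_Mapping.single i 1) = (\<Prod>j\<in>UNIV. if i = j then x j else 1)"
    unfolding monomial_value_def
    by (rule prod.cong) (auto simp: lookup_single when_def)
  then show ?thesis by simp
qed

lemma rat_eval_var: "rat_eval x (Poly_Mapping.single (Poly_Mapping.single i 1) 1) = x i"
  by (simp only: rat_eval_single monomial_value_single) simp

lemma poly_eval_of_int:
  fixes P :: "('n::finite \<Rightarrow>\<^sub>0 nat) \<Rightarrow>\<^sub>0 int" and x :: "'n \<Rightarrow> 'a::field_char_0"
  shows "poly_eval of_int x P = rat_eval x (Poly_Mapping.map of_int P)"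
proof -
  have "Poly_Mapping.keys (Poly_Mapping.map (of_int :: int \<Rightarrow> rat) P) = Poly_Mapping.keys P"
    by (auto simp: in_keys_iff Poly_Mapping.map.rep_eq when_def)
  then show ?thesis
    by (auto simp: poly_eval_def Poly_Mapping.map.rep_eq when_def in_keys_iff intro!: sum.cong)
qed


section \<open>Homomorphisms of the ambient field\<close>

definition field_hom :: "('a::field_char_0 \<Rightarrow> 'a) \<Rightarrow> bool" where
  "field_hom f \<longleftrightarrow> f 1 = 1 \<and> (\<forall>a b. f (a + b) = f a + f b) \<and> (\<forall>a b. f (a * b) = f a * f b)"

lemma field_homD:
  assumes "field_hom f"
  shows field_hom_1: "f 1 = 1" and field_hom_add: "f (a + b) = f a + f b"
    and field_hom_mult: "f (a * b) = f a * f b"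
  using assms by (auto simp: field_hom_def)

lemma field_hom_0: "field_hom f \<Longrightarrow> f 0 = 0"
  using field_hom_add[of f 0 0] by simp

lemma field_hom_uminus: "field_hom f \<Longrightarrow> f (- a) = - f a"
  using field_hom_add[of f a "- a"] by (simp add: field_hom_0 eq_neg_iff_add_eq_0 add.commute)

lemma field_hom_diff: "field_hom f \<Longrightarrow> f (a - b) = f a - f b"
  using field_hom_add[of f a "- b"] by (simp add: field_hom_uminus)

lemma field_hom_inverse: "field_hom f \<Longrightarrow> f (inverse a) = inverse (f a)"
proof (cases "a = 0")
  case False
  assume f: "field_hom f"
  have "f a * f (inverse a) = 1"
    using field_hom_mult[OF f, of a "inverse a"] False by (simp add: field_hom_1[OF f])
  then show ?thesis by (metis inverse_unique)
qed (simp add: field_hom_0)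

lemma field_hom_divide: "field_hom f \<Longrightarrow> f (a / b) = f a / f b"
  by (simp add: divide_inverse field_hom_mult field_hom_inverse)

lemma field_hom_power: "field_hom f \<Longrightarrow> f (a ^ k) = f a ^ k"
  by (induction k) (simp_all add: field_hom_1 field_hom_mult)

lemma field_hom_prod: "field_hom f \<Longrightarrow> f (\<Prod>a\<in>S. g a) = (\<Prod>a\<in>S. f (g a))"
  by (induction S rule: infinite_finite_induct) (simp_all add: field_hom_1 field_hom_mult)

lemma field_hom_sum: "field_hom f \<Longrightarrow> f (\<Sum>a\<in>S. g a) = (\<Sum>a\<in>S. f (g a))"
  by (induction S rule: infinite_finite_induct) (simp_all add: field_hom_0 field_hom_add)

lemma field_hom_of_nat: "field_hom f \<Longrightarrow> f (of_nat k) = of_nat k"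
  by (induction k) (simp_all add: field_hom_0 field_hom_1 field_hom_add)

lemma field_hom_of_int: "field_hom f \<Longrightarrow> f (of_int k) = of_int k"
  by (cases k) (simp_all add: field_hom_of_nat field_hom_diff field_hom_uminus field_hom_1)

lemma field_hom_of_rat: "field_hom f \<Longrightarrow> f (of_rat r) = of_rat r"
  by (cases r) (simp add: of_rat_rat field_hom_of_int field_hom_divide)

lemma field_hom_rat_eval: "field_hom f \<Longrightarrow> f (rat_eval x p) = rat_eval (f \<circ> x) p"
  by (simp add: poly_eval_def field_hom_sum field_hom_mult field_hom_of_rat field_hom_prod
      field_hom_power)

lemma field_hom_comp: "field_hom f \<Longrightarrow> field_hom g \<Longrightarrow> field_hom (f \<circ> g)"
  by (simp add: field_hom_def)

lemma free_generatingE: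
  assumes "free_generating x"
  obtains p q where "rat_eval x q \<noteq> 0" and "z = rat_eval x p / rat_eval x q"
  using assms by (meson free_generating_def)

lemma field_hom_eq_on_generators:
  assumes "free_generating x" and f: "field_hom f" and g: "field_hom g"
    and "\<And>i. f (x i) = g (x i)"
  shows "f = g"
proof
  fix z
  obtain p q where z: "z = rat_eval x p / rat_eval x q"
    using free_generatingE[OF assms(1)] by metis
  have "f \<circ> x = g \<circ> x" using assms(4) by auto
  then show "f z = g z"
    by (simp add: z field_hom_divide[OF f] field_hom_divide[OF g]
        field_hom_rat_eval[OF f] field_hom_rat_eval[OF g])
qed

definition alg_independent :: "('n::finite \<Rightarrow> 'a::field_char_0) \<Rightarrow> bool" where
  "alg_independent y \<longleftrightarrow> (\<forall>p. rat_eval y p = 0 \<longrightarrow> p = 0)"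

lemma free_generating_alg_independent: "free_generating x \<Longrightarrow> alg_independent x"
  by (simp add: free_generating_def alg_independent_def)

lemma alg_independentD: "alg_independent y \<Longrightarrow> rat_eval y p = 0 \<Longrightarrow> p = 0"
  by (simp add: alg_independent_def)

lemma alg_independent_inj: "alg_independent y \<Longrightarrow> rat_eval y p = rat_eval y q \<Longrightarrow> p = q"
  using alg_independentD[of y "p - q"] by (simp add: rat_eval_diff)

text \<open>Substitute \<open>y\<^sub>i\<close> for \<open>x\<^sub>i\<close>: denominators stay nonzero because the \<open>y\<^sub>i\<close> are algebraically
  independent, and two quotients with the same value at \<open>x\<close> agree at \<open>y\<close> because the \<open>x\<^sub>i\<close> are.\<close>

lemma field_hom_extension:
  fixes x y :: "'n::finite \<Rightarrow> 'a::field_char_0"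
  assumes x: "free_generating x" and y: "alg_independent y"
  obtains f where "field_hom f" and "\<And>i. f (x i) = y i"
proof -
  have "\<forall>z. \<exists>p q. rat_eval x q \<noteq> 0 \<and> z = rat_eval x p / rat_eval x q"
    using x by (simp add: free_generating_def)
  then obtain num den where nd: "\<And>z. rat_eval x (den z) \<noteq> 0"
      "\<And>z. z = rat_eval x (num z) / rat_eval x (den z)"
    by metis
  define f where "f z = rat_eval y (num z) / rat_eval y (den z)" for z
  have nonzero: "rat_eval y q \<noteq> 0" if "rat_eval x q \<noteq> 0" for q
    using that alg_independentD[OF y, of q] by (auto simp: rat_eval_0)
  have f_eq: "f z = rat_eval y p / rat_eval y q"
    if q: "rat_eval x q \<noteq> 0" and z: "z = rat_eval x p / rat_eval x q" for z p q
  proof -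
    have "rat_eval x (num z) / rat_eval x (den z) = rat_eval x p / rat_eval x q"
      using nd(2)[of z] z by metis
    then have "rat_eval x (num z * q) = rat_eval x (p * den z)"
      using nd(1)[of z] q by (simp add: rat_eval_mult field_simps)
    then have "num z * q = p * den z"
      by (rule alg_independent_inj[OF free_generating_alg_independent[OF x]])
    then have "rat_eval y (num z) * rat_eval y q = rat_eval y p * rat_eval y (den z)"
      by (metis rat_eval_mult)
    then show ?thesis
      using nonzero[OF q] nonzero[OF nd(1)[of z]] by (simp add: f_def field_simps)
  qed
  have add: "f (a + b) = f a + f b" for a b
  proof -
    have "f (a + b) = rat_eval y (num a * den b + num b * den a) / rat_eval y (den a * den b)"
    proof (rule f_eq)
      show "rat_eval x (den a * den b) \<noteq> 0" using nd(1) by (simp add: rat_eval_mult)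
      have "a + b = rat_eval x (num a) / rat_eval x (den a) + rat_eval x (num b) / rat_eval x (den b)"
        using nd(2)[of a] nd(2)[of b] by simp
      then show "a + b = rat_eval x (num a * den b + num b * den a) / rat_eval x (den a * den b)"
        using nd(1)[of a] nd(1)[of b] by (simp add: rat_eval_mult rat_eval_add add_frac_eq)
    qed
    then show ?thesis
      using nonzero[OF nd(1)[of a]] nonzero[OF nd(1)[of b]]
      by (simp add: f_def rat_eval_mult rat_eval_add field_simps)
  qed
  have mult: "f (a * b) = f a * f b" for a b
  proof -
    have "f (a * b) = rat_eval y (num a * num b) / rat_eval y (den a * den b)"
    proof (rule f_eq)
      show "rat_eval x (den a * den b) \<noteq> 0" using nd(1) by (simp add: rat_eval_mult)
      have "a * b = rat_eval x (num a) / rat_eval x (den a) * (rat_eval x (num b) / rat_eval x (den b))"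
        using nd(2)[of a] nd(2)[of b] by simp
      then show "a * b = rat_eval x (num a * num b) / rat_eval x (den a * den b)"
        by (simp add: rat_eval_mult)
    qed
    then show ?thesis
      by (simp add: f_def rat_eval_mult)
  qed
  have "f 1 = 1"
    using f_eq[of 1 1 1] by (simp add: rat_eval_1)
  with add mult have "field_hom f" by (simp add: field_hom_def)
  moreover have "f (x i) = y i" for i
    using f_eq[of 1 "x i" "Poly_Mapping.single (Poly_Mapping.single i 1) 1"]
    by (simp only: rat_eval_var rat_eval_1) simp
  ultimately show ?thesis by (rule that)
qed

text \<open>Laurent polynomials, seen as functions on tuples without zero entries. The denominator is
  always a power of the product of all coordinates, so that sums have a common one.\<close>

definition laurent_map :: "(('n::finite \<Rightarrow> 'a::field_char_0) \<Rightarrow> 'a) \<Rightarrow> bool" where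
  "laurent_map g \<longleftrightarrow> (\<exists>p D. \<forall>y. (\<forall>i. y i \<noteq> 0) \<longrightarrow> g y * (\<Prod>i\<in>UNIV. y i) ^ D = rat_eval y p)"

definition all_variables :: "('n::finite \<Rightarrow>\<^sub>0 nat) \<Rightarrow>\<^sub>0 rat" where
  "all_variables = (\<Prod>i\<in>UNIV. Poly_Mapping.single (Poly_Mapping.single i 1) 1)"

lemma rat_eval_prod: "rat_eval y (\<Prod>a\<in>S. g a) = (\<Prod>a\<in>S. rat_eval y (g a))"
  by (induction S rule: infinite_finite_induct) (simp_all add: rat_eval_1 rat_eval_mult)

lemma rat_eval_power: "rat_eval y (p ^ k) = rat_eval y p ^ k"
  by (induction k) (simp_all add: rat_eval_1 rat_eval_mult)

lemma rat_eval_all_variables: "rat_eval y all_variables = (\<Prod>i\<in>UNIV. y i)"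
  by (simp only: all_variables_def rat_eval_prod rat_eval_var)

lemma laurent_map_polynomial: "(\<And>y. g y = rat_eval y p) \<Longrightarrow> laurent_map g"
  unfolding laurent_map_def by (rule exI[of _ p], rule exI[of _ 0]) simp

lemma laurent_map_mult:
  assumes "laurent_map g" and "laurent_map h"
  shows "laurent_map (\<lambda>y. g y * h y)"
proof -
  obtain p D q E where g: "\<And>y. (\<forall>i. y i \<noteq> 0) \<Longrightarrow> g y * (\<Prod>i\<in>UNIV. y i) ^ D = rat_eval y p"
    and h: "\<And>y. (\<forall>i. y i \<noteq> 0) \<Longrightarrow> h y * (\<Prod>i\<in>UNIV. y i) ^ E = rat_eval y q"
    using assms unfolding laurent_map_def by metis
  have "g y * h y * (\<Prod>i\<in>UNIV. y i) ^ (D + E) = rat_eval y (p * q)" if "\<forall>i. y i \<noteq> 0" for y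
    unfolding rat_eval_mult g[OF that, symmetric] h[OF that, symmetric]
    by (simp add: power_add mult_ac)
  then show ?thesis unfolding laurent_map_def by blast
qed

lemma laurent_map_add:
  assumes "laurent_map g" and "laurent_map h"
  shows "laurent_map (\<lambda>y. g y + h y)"
proof -
  obtain p D q E where g: "\<And>y. (\<forall>i. y i \<noteq> 0) \<Longrightarrow> g y * (\<Prod>i\<in>UNIV. y i) ^ D = rat_eval y p"
    and h: "\<And>y. (\<forall>i. y i \<noteq> 0) \<Longrightarrow> h y * (\<Prod>i\<in>UNIV. y i) ^ E = rat_eval y q"
    using assms unfolding laurent_map_def by metis
  have "(g y + h y) * (\<Prod>i\<in>UNIV. y i) ^ (D + E)
      = rat_eval y (p * all_variables ^ E + q * all_variables ^ D)" if "\<forall>i. y i \<noteq> 0" for y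
    using that
    by (simp add: rat_eval_mult rat_eval_add rat_eval_power rat_eval_all_variables power_add
        flip: g h) (simp add: algebra_simps)
  then show ?thesis unfolding laurent_map_def by blast
qed

lemma laurent_map_const: "laurent_map (\<lambda>y. of_rat c)"
  by (rule laurent_map_polynomial) (rule rat_eval_const[symmetric])

lemma laurent_map_var: "laurent_map (\<lambda>y. y i)"
  by (rule laurent_map_polynomial) (rule rat_eval_var[symmetric])

lemma laurent_map_inverse_var: "laurent_map (\<lambda>y :: 'n::finite \<Rightarrow> 'a::field_char_0. 1 / y i)"
proof -
  have "1 / y i * (\<Prod>i\<in>UNIV. y i) ^ 1
      = rat_eval y (\<Prod>j\<in>UNIV - {i}. Poly_Mapping.single (Poly_Mapping.single j 1) 1)"
    if "\<forall>i. y i \<noteq> 0" for y :: "'n \<Rightarrow> 'a"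
    using that by (simp only: rat_eval_prod rat_eval_var)
      (simp add: prod.remove[of UNIV i])
  then show ?thesis unfolding laurent_map_def by blast
qed

lemma laurent_map_1: "laurent_map (\<lambda>y. 1)"
  using laurent_map_const[of 1] by simp

lemma laurent_map_prod: "(\<And>a. a \<in> S \<Longrightarrow> laurent_map (g a)) \<Longrightarrow> laurent_map (\<lambda>y. \<Prod>a\<in>S. g a y)"
  by (induction S rule: infinite_finite_induct) (simp_all add: laurent_map_1 laurent_map_mult)

lemma laurent_map_sum: "(\<And>a. a \<in> S \<Longrightarrow> laurent_map (g a)) \<Longrightarrow> laurent_map (\<lambda>y. \<Sum>a\<in>S. g a y)"
proof (induction S rule: infinite_finite_induct)
  case (insert a S)
  then show ?case by (simp add: laurent_map_add)
qed (use laurent_map_const[of 0] in simp_all)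

lemma laurent_map_power: "laurent_map g \<Longrightarrow> laurent_map (\<lambda>y. g y ^ k)"
  by (induction k) (simp_all add: laurent_map_1 laurent_map_mult)

text \<open>A polynomial relation \<open>p\<close> among the \<open>\<phi> x\<close> becomes, after clearing denominators, a relation
  among the \<open>x\<close>, so it holds identically; evaluated at \<open>\<phi> x\<close> it then says that \<open>p\<close> vanishes at
  \<open>\<phi> (\<phi> x) = x\<close>.\<close>

lemma alg_independent_laurent_involution:
  assumes "alg_independent x" and "\<And>i. laurent_map (\<lambda>y. \<phi> y i)"
    and "\<And>i. x i \<noteq> 0" and "\<And>i. \<phi> x i \<noteq> 0" and inv: "\<phi> (\<phi> x) = x"
  shows "alg_independent (\<phi> x)"
  unfolding alg_independent_def
proof (intro allI impI)
  fix p assume p: "rat_eval (\<phi> x) p = 0"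
  have "laurent_map (\<lambda>y. rat_eval (\<phi> y) p)"
    unfolding poly_eval_def
    by (intro laurent_map_sum laurent_map_mult laurent_map_prod laurent_map_power
        laurent_map_const assms(2))
  then obtain r D where r: "\<And>y. (\<forall>i. y i \<noteq> 0) \<Longrightarrow>
      rat_eval (\<phi> y) p * (\<Prod>i\<in>UNIV. y i) ^ D = rat_eval y r"
    unfolding laurent_map_def by blast
  have "rat_eval x r = 0"
    using r[of x] p assms(3) by simp
  then have "r = 0" by (rule alg_independentD[OF assms(1)])
  then have "rat_eval x p = 0"
    using r[of "\<phi> x"] assms(4) by (simp add: inv rat_eval_0)
  then show "p = 0" by (rule alg_independentD[OF assms(1)])
qed


section \<open>Initial exponents of subtraction-free elements\<close>

text \<open>Logarithms of distinct primes are linearly independent over the integers, by unique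
  factorization.\<close>

lemma independent_weights_exist:
  obtains w :: "'n::finite \<Rightarrow> real"
  where "\<And>i. w i > 0"
    and "\<And>v :: int^'n. (\<Sum>i\<in>UNIV. of_int (v $ i) * w i) = 0 \<Longrightarrow> v = 0"
proof -
  obtain S :: "nat set" where S: "finite S" "card S = CARD('n)" "S \<subseteq> {p. prime p}"
    using infinite_arbitrarily_large[OF primes_infinite] by metis
  obtain p :: "'n \<Rightarrow> nat" where p: "bij_betw p UNIV S"
    using finite_same_card_bij[of "UNIV :: 'n set" S] S by auto
  have prime: "prime (p i)" for i
    using p S(3) by (auto simp: bij_betw_def)
  have inj: "inj p" using p by (simp add: bij_betw_def)
  have pos: "ln (real (p i)) > 0" for i
    using prime_gt_1_nat[OF prime[of i]] by simp
  have mult: "multiplicity (p i) (\<Prod>j\<in>UNIV. p j ^ e j) = e i" for i and e :: "'n \<Rightarrow> nat"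
  proof -
    have "(\<Prod>j\<in>UNIV. p j ^ e j) = (\<Prod>q\<in>range p. q ^ e (inv p q))"
      by (simp add: prod.reindex[OF inj] inj)
    then show ?thesis
      using multiplicity_prod_prime_powers[of "range p" "p i" "\<lambda>q. e (inv p q)"] prime
      by (auto simp: inj)
  qed
  have "v = 0" if v: "(\<Sum>i\<in>UNIV. of_int (v $ i) * ln (real (p i))) = 0" for v :: "int^'n"
  proof -
    let ?P = "\<lambda>e :: 'n \<Rightarrow> nat. (\<Prod>i\<in>UNIV. p i ^ e i)"
    have ln: "ln (real (?P e)) = (\<Sum>i\<in>UNIV. real (e i) * ln (real (p i)))" for e
      using prime_gt_0_nat[OF prime] by (simp add: ln_prod ln_realpow of_nat_prod)
    have "real_of_int (v $ i) = real (nat (v $ i)) - real (nat (- (v $ i)))" for i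
      by linarith
    then have "(\<Sum>i\<in>UNIV. real (nat (v $ i)) * ln (real (p i)))
        = (\<Sum>i\<in>UNIV. real (nat (- (v $ i))) * ln (real (p i)))"
      using v by (simp add: left_diff_distrib sum_subtractf)
    then have "ln (real (?P (\<lambda>i. nat (v $ i)))) = ln (real (?P (\<lambda>i. nat (- (v $ i)))))"
      by (simp only: ln)
    moreover have "real (?P e) > 0" for e
      using prime_gt_0_nat[OF prime] by (simp add: prod_pos)
    ultimately have "real (?P (\<lambda>i. nat (v $ i))) = real (?P (\<lambda>i. nat (- (v $ i))))"
      by (simp only: ln_inj_iff)
    then have "?P (\<lambda>i. nat (v $ i)) = ?P (\<lambda>i. nat (- (v $ i)))"
      by (simp only: of_nat_eq_iff)
    then have "nat (v $ i) = nat (- (v $ i))" for i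
      using mult[of i "\<lambda>i. nat (v $ i)"] mult[of i "\<lambda>i. nat (- (v $ i))"] by simp
    then have "v $ i = 0" for i
      by (metis nat_0_iff neg_le_0_iff_le linorder_linear nat_eq_iff neg_equal_iff_equal
          order_antisym)
    then show ?thesis by (simp add: vec_eq_iff)
  qed
  with pos show ?thesis by (rule that)
qed

lemma simple_root_nth: "simple_root i $ a = (if i = a then 1 else 0)"
  by (simp add: simple_root_def axis_def)

text \<open>The weights \<open>w\<close> order the exponents of monomials in \<open>x\<close>. Independence makes the order total,
  and positivity makes the zero exponent the smallest one.\<close>

locale initial_terms =
  fixes x :: "'n::finite \<Rightarrow> 'f::field_char_0" and w :: "'n \<Rightarrow> real"
  assumes indep: "alg_independent x"
    and w_pos: "w i > 0"
    and w_indep: "(\<Sum>i\<in>UNIV. of_int (v $ i) * w i) = 0 \<Longrightarrow> v = 0"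
begin

definition weight :: "int^'n \<Rightarrow> real" where
  "weight v = (\<Sum>i\<in>UNIV. of_int (v $ i) * w i)"

definition expo :: "('n \<Rightarrow>\<^sub>0 nat) \<Rightarrow> int^'n" where
  "expo m = (\<chi> i. int (Poly_Mapping.lookup m i))"

lemma weight_add: "weight (u + v) = weight u + weight v"
  by (simp add: weight_def distrib_right sum.distrib)

lemma weight_diff: "weight (u - v) = weight u - weight v"
  by (simp add: weight_def left_diff_distrib sum_subtractf)

lemma weight_0: "weight 0 = 0"
  by (simp add: weight_def)

lemma weight_nonneg: "(\<And>i. v $ i \<ge> 0) \<Longrightarrow> weight v \<ge> 0"
  unfolding weight_def by (intro sum_nonneg mult_nonneg_nonneg) (simp_all add: w_pos less_imp_le)

lemma weight_inj: "weight u = weight v \<Longrightarrow> u = v"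
  using w_indep[of "u - v"] weight_diff[of u v] by (simp add: weight_def)

lemma expo_add: "expo (m + m') = expo m + expo m'"
  by (simp add: expo_def lookup_add vec_eq_iff)

lemma expo_inj: "expo m = expo m' \<Longrightarrow> m = m'"
  by (rule poly_mapping_eqI) (simp add: expo_def vec_eq_iff)

definition lowest :: "(('n \<Rightarrow>\<^sub>0 nat) \<Rightarrow>\<^sub>0 rat) \<Rightarrow> ('n \<Rightarrow>\<^sub>0 nat) \<Rightarrow> bool" where
  "lowest p m \<longleftrightarrow> m \<in> Poly_Mapping.keys p \<and>
     (\<forall>m'\<in>Poly_Mapping.keys p. weight (expo m) \<le> weight (expo m'))"

lemma lowest_unique: "lowest p m \<Longrightarrow> lowest p m' \<Longrightarrow> m = m'"
  unfolding lowest_def by (meson expo_inj weight_inj order_antisym)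

lemma lowest_nonzero: "lowest p m \<Longrightarrow> p \<noteq> 0"
  by (auto simp: lowest_def)

lemma lookup_mult_double_sum:
  fixes p q :: "('n \<Rightarrow>\<^sub>0 nat) \<Rightarrow>\<^sub>0 rat"
  shows "Poly_Mapping.lookup (p * q) k = (\<Sum>m\<in>Poly_Mapping.keys p. \<Sum>m'\<in>Poly_Mapping.keys q.
    (if m + m' = k then Poly_Mapping.lookup p m * Poly_Mapping.lookup q m' else 0))"
  by (subst mult_sum_singles) (simp add: lookup_sum lookup_single when_def)

text \<open>Weights separate exponents, so the product of the two lowest terms meets no other term of
  the product and cannot cancel.\<close>

lemma lowest_mult:
  assumes "lowest p m" and "lowest q m'"
  shows "lowest (p * q) (m + m')"
proof -
  have m: "m \<in> Poly_Mapping.keys p" "\<And>k. k \<in> Poly_Mapping.keys p \<Longrightarrow> weight (expo m) \<le> weight (expo k)"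
    and m': "m' \<in> Poly_Mapping.keys q" "\<And>k. k \<in> Poly_Mapping.keys q \<Longrightarrow> weight (expo m') \<le> weight (expo k)"
    using assms by (auto simp: lowest_def)
  have only: "k = m \<and> k' = m'"
    if "k \<in> Poly_Mapping.keys p" "k' \<in> Poly_Mapping.keys q" "k + k' = m + m'" for k k'
  proof -
    have "weight (expo k) + weight (expo k') = weight (expo m) + weight (expo m')"
      using that(3) by (metis weight_add expo_add)
    then have "weight (expo k) = weight (expo m)" "weight (expo k') = weight (expo m')"
      using m(2)[OF that(1)] m'(2)[OF that(2)] by auto
    then show ?thesis by (metis weight_inj expo_inj)
  qed
  have "Poly_Mapping.lookup (p * q) (m + m') = (\<Sum>k\<in>Poly_Mapping.keys p. \<Sum>k'\<in>Poly_Mapping.keys q.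
      if k = m \<and> k' = m' then Poly_Mapping.lookup p m * Poly_Mapping.lookup q m' else 0)"
    unfolding lookup_mult_double_sum using only by (intro sum.cong refl) auto
  also have "\<dots> = (\<Sum>k\<in>Poly_Mapping.keys p. if k = m then
      (\<Sum>k'\<in>Poly_Mapping.keys q. if k' = m' then Poly_Mapping.lookup p m * Poly_Mapping.lookup q m' else 0)
      else 0)"
    by (intro sum.cong refl) simp
  also have "\<dots> = Poly_Mapping.lookup p m * Poly_Mapping.lookup q m'"
    using m(1) m'(1) by simp
  finally have "m + m' \<in> Poly_Mapping.keys (p * q)"
    using m(1) m'(1) by (simp add: in_keys_iff)
  moreover have "weight (expo (m + m')) \<le> weight (expo k)" if k: "k \<in> Poly_Mapping.keys (p * q)" for k
  proof -
    obtain a b where "k = a + b" "a \<in> Poly_Mapping.keys p" "b \<in> Poly_Mapping.keys q"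
      using Poly_Mapping.keys_mult[of p q] k by auto
    then show ?thesis
      using m(2)[of a] m'(2)[of b] by (simp add: expo_add weight_add)
  qed
  ultimately show ?thesis by (simp add: lowest_def)
qed

definition nonneg_poly :: "(('n \<Rightarrow>\<^sub>0 nat) \<Rightarrow>\<^sub>0 rat) \<Rightarrow> bool" where
  "nonneg_poly p \<longleftrightarrow> (\<forall>m. Poly_Mapping.lookup p m \<ge> 0)"

lemma nonneg_poly_mult: "nonneg_poly p \<Longrightarrow> nonneg_poly q \<Longrightarrow> nonneg_poly (p * q)"
  unfolding nonneg_poly_def lookup_mult_double_sum by (auto intro!: sum_nonneg)

lemma nonneg_poly_add: "nonneg_poly p \<Longrightarrow> nonneg_poly q \<Longrightarrow> nonneg_poly (p + q)"
  by (simp add: nonneg_poly_def lookup_add)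

lemma lowest_add:
  assumes "nonneg_poly p" "nonneg_poly q" and m: "lowest p m" and m': "lowest q m'"
    and "weight (expo m) \<le> weight (expo m')"
  shows "lowest (p + q) m"
proof -
  have "Poly_Mapping.lookup p m > 0" "Poly_Mapping.lookup q m \<ge> 0"
    using m assms(1,2) by (auto simp: lowest_def in_keys_iff nonneg_poly_def order.strict_iff_order)
  then have "m \<in> Poly_Mapping.keys (p + q)"
    by (simp add: in_keys_iff lookup_add)
  then show ?thesis
    using m m' assms(5) Poly_Mapping.keys_add[of p q]
    unfolding lowest_def by (meson UnE order_trans subsetD)
qed

text \<open>This is a monomial valuation, restricted to the quotients of polynomials with nonnegative
  coefficients. On these, lowest terms never cancel in a sum, so the valuation of a sum is exactly
  the minimum and not just bounded below by it.\<close>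

definition has_initial_exponent :: "'f \<Rightarrow> int^'n \<Rightarrow> bool" where
  "has_initial_exponent z g \<longleftrightarrow> (\<exists>p q m m'. nonneg_poly p \<and> nonneg_poly q \<and> lowest p m \<and> lowest q m' \<and>
     z = rat_eval x p / rat_eval x q \<and> g = expo m - expo m')"

lemma rat_eval_nonzero: "lowest p m \<Longrightarrow> rat_eval x p \<noteq> 0"
  using alg_independentD[OF indep] lowest_nonzero by blast

lemma has_initial_exponent_nonzero: "has_initial_exponent z g \<Longrightarrow> z \<noteq> 0"
  unfolding has_initial_exponent_def by (auto simp: rat_eval_nonzero)

lemma initial_exponent_unique:
  assumes "has_initial_exponent z g" and "has_initial_exponent z h"
  shows "g = h"
proof -
  obtain p q m m' where 1: "lowest p m" "lowest q m'" "z = rat_eval x p / rat_eval x q"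
      "g = expo m - expo m'"
    using assms(1) by (auto simp: has_initial_exponent_def)
  obtain r s k k' where 2: "lowest r k" "lowest s k'" "z = rat_eval x r / rat_eval x s"
      "h = expo k - expo k'"
    using assms(2) by (auto simp: has_initial_exponent_def)
  have "rat_eval x (p * s) = rat_eval x (r * q)"
    using 1(3) 2(3) rat_eval_nonzero[OF 1(2)] rat_eval_nonzero[OF 2(2)]
    by (simp add: rat_eval_mult field_simps)
  then have "p * s = r * q"
    by (rule alg_independent_inj[OF indep])
  then have "m + k' = k + m'"
    using lowest_mult[OF 1(1) 2(2)] lowest_mult[OF 2(1) 1(2)] lowest_unique by simp
  then have "expo m + expo k' = expo k + expo m'"
    by (metis expo_add)
  then show ?thesis
    by (simp add: 1(4) 2(4) algebra_simps)
qed

lemma initial_exponent_mult: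
  assumes "has_initial_exponent z g" and "has_initial_exponent z' h"
  shows "has_initial_exponent (z * z') (g + h)"
proof -
  obtain p q m m' where 1: "nonneg_poly p" "nonneg_poly q" "lowest p m" "lowest q m'"
      "z = rat_eval x p / rat_eval x q" "g = expo m - expo m'"
    using assms(1) by (auto simp: has_initial_exponent_def)
  obtain r s k k' where 2: "nonneg_poly r" "nonneg_poly s" "lowest r k" "lowest s k'"
      "z' = rat_eval x r / rat_eval x s" "h = expo k - expo k'"
    using assms(2) by (auto simp: has_initial_exponent_def)
  show ?thesis
    unfolding has_initial_exponent_def
  proof (intro exI conjI)
    show "nonneg_poly (p * r)" "nonneg_poly (q * s)"
      using 1 2 nonneg_poly_mult by auto
    show "lowest (p * r) (m + k)" "lowest (q * s) (m' + k')"
      using 1 2 lowest_mult by auto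
  qed (simp_all add: 1 2 rat_eval_mult expo_add)
qed

lemma initial_exponent_inverse:
  assumes "has_initial_exponent z g"
  shows "has_initial_exponent (1 / z) (- g)"
proof -
  obtain p q m m' where 1: "nonneg_poly p" "nonneg_poly q" "lowest p m" "lowest q m'"
      "z = rat_eval x p / rat_eval x q" "g = expo m - expo m'"
    using assms(1) by (auto simp: has_initial_exponent_def)
  show ?thesis
    unfolding has_initial_exponent_def
    by (rule exI[of _ q], rule exI[of _ p], rule exI[of _ m'], rule exI[of _ m]) (simp add: 1)
qed

lemma initial_exponent_divide:
  "has_initial_exponent z g \<Longrightarrow> has_initial_exponent z' h \<Longrightarrow> has_initial_exponent (z / z') (g - h)"
  using initial_exponent_mult[of z g "1 / z'" "- h"] initial_exponent_inverse[of z' h] by simp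

lemma initial_exponent_add:
  assumes "has_initial_exponent z g" and "has_initial_exponent z' h" and le: "weight g \<le> weight h"
  shows "has_initial_exponent (z + z') g"
proof -
  obtain p q m m' where 1: "nonneg_poly p" "nonneg_poly q" "lowest p m" "lowest q m'"
      "z = rat_eval x p / rat_eval x q" "g = expo m - expo m'"
    using assms(1) by (auto simp: has_initial_exponent_def)
  obtain r s k k' where 2: "nonneg_poly r" "nonneg_poly s" "lowest r k" "lowest s k'"
      "z' = rat_eval x r / rat_eval x s" "h = expo k - expo k'"
    using assms(2) by (auto simp: has_initial_exponent_def)
  show ?thesis
    unfolding has_initial_exponent_def
  proof (intro exI conjI)
    show "nonneg_poly (p * s + r * q)" "nonneg_poly (q * s)"
      using 1 2 nonneg_poly_mult nonneg_poly_add by auto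
    show "lowest (q * s) (m' + k')"
      using 1 2 lowest_mult by auto
    show "lowest (p * s + r * q) (m + k')"
    proof (rule lowest_add)
      show "lowest (p * s) (m + k')" "lowest (r * q) (k + m')"
        using 1 2 lowest_mult by auto
      show "weight (expo (m + k')) \<le> weight (expo (k + m'))"
        using le by (simp add: 1 2 expo_add weight_add weight_diff)
    qed (use 1 2 nonneg_poly_mult in auto)
    show "z + z' = rat_eval x (p * s + r * q) / rat_eval x (q * s)"
      using rat_eval_nonzero[OF 1(4)] rat_eval_nonzero[OF 2(4)]
      by (simp add: 1 2 rat_eval_mult rat_eval_add add_frac_eq)
  qed (simp add: 1 2 expo_add)
qed

lemma lowest_single: "c \<noteq> 0 \<Longrightarrow> lowest (Poly_Mapping.single m c) m"
  by (simp add: lowest_def)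

lemma nonneg_poly_single: "c \<ge> 0 \<Longrightarrow> nonneg_poly (Poly_Mapping.single m c)"
  by (simp add: nonneg_poly_def lookup_single when_def)

lemma expo_0: "expo 0 = 0"
  by (simp add: expo_def vec_eq_iff)

lemma initial_exponent_monomial: "has_initial_exponent (monomial_value x m) (expo m)"
  unfolding has_initial_exponent_def
  by (rule exI[of _ "Poly_Mapping.single m 1"], rule exI[of _ "Poly_Mapping.single 0 1"],
      rule exI[of _ m], rule exI[of _ 0])
    (simp add: lowest_single nonneg_poly_single rat_eval_single expo_0 monomial_value_0
      del: single_one)

lemma initial_exponent_1: "has_initial_exponent 1 0"
  using initial_exponent_monomial[of 0] by (simp add: monomial_value_0 expo_0)

lemma initial_exponent_var: "has_initial_exponent (x i) (simple_root i)"
proof -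
  have "expo (Poly_Mapping.single i 1) = simple_root i"
    by (simp add: expo_def simple_root_def vec_eq_iff axis_def lookup_single when_def)
  then show ?thesis
    using initial_exponent_monomial[of "Poly_Mapping.single i 1"]
    by (simp only: monomial_value_single)
qed

lemma initial_exponent_power:
  "has_initial_exponent z g \<Longrightarrow> has_initial_exponent (z ^ k) (int k *s g)"
proof (induction k)
  case (Suc k)
  have "int (Suc k) *s g = g + int k *s g"
    by (simp add: vec_eq_iff algebra_simps)
  with initial_exponent_mult[OF Suc.prems Suc.IH[OF Suc.prems]] show ?case
    by simp
qed (simp add: initial_exponent_1)

lemma initial_exponent_prod:
  assumes "\<And>a. a \<in> S \<Longrightarrow> has_initial_exponent (z a) (g a)"
  shows "has_initial_exponent (\<Prod>a\<in>S. z a ^ e a) (\<Sum>a\<in>S. int (e a) *s g a)"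
  using assms
  by (induction S rule: infinite_finite_induct)
    (simp_all add: initial_exponent_1 initial_exponent_mult initial_exponent_power)

text \<open>All weights are positive, so the constant term of \<open>P\<close> is its lowest term even when \<open>P\<close>
  has negative coefficients elsewhere.\<close>

lemma initial_exponent_denominator:
  fixes P :: "('n \<Rightarrow>\<^sub>0 nat) \<Rightarrow>\<^sub>0 int"
  assumes z: "has_initial_exponent z g"
    and P: "Poly_Mapping.lookup P 0 \<noteq> 0"
    and z_eq: "z = poly_eval of_int x P / (\<Prod>j\<in>UNIV. x j ^ nat (\<alpha> $ j))"
    and \<alpha>: "\<And>j. \<alpha> $ j \<ge> 0"
  shows "g = - \<alpha>"
proof -
  obtain p q m m' where 1: "lowest p m" "lowest q m'" "z = rat_eval x p / rat_eval x q"
      "g = expo m - expo m'"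
    using z by (auto simp: has_initial_exponent_def)
  define P' where "P' = Poly_Mapping.map (rat_of_int) P"
  have "0 \<in> Poly_Mapping.keys P'"
    using P by (simp add: P'_def in_keys_iff Poly_Mapping.map.rep_eq)
  moreover have "weight (expo 0) \<le> weight (expo k)" for k
    by (simp add: expo_0 weight_0) (rule weight_nonneg, simp add: expo_def)
  ultimately have P': "lowest P' 0"
    by (simp add: lowest_def)
  define k :: "'n \<Rightarrow>\<^sub>0 nat" where "k = Abs_poly_mapping (\<lambda>j. nat (\<alpha> $ j))"
  have k: "Poly_Mapping.lookup k j = nat (\<alpha> $ j)" for j
    by (simp add: k_def)
  have "z = rat_eval x P' / monomial_value x k"
    by (simp add: z_eq poly_eval_of_int P'_def monomial_value_def k)
  then have "rat_eval x P' / rat_eval x (Poly_Mapping.single k 1) = rat_eval x p / rat_eval x q"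
    by (simp add: 1(3) rat_eval_single)
  then have "rat_eval x (P' * q) = rat_eval x (p * Poly_Mapping.single k 1)"
    using rat_eval_nonzero[OF 1(2)] rat_eval_nonzero[OF lowest_single[of 1 k]]
    by (simp add: rat_eval_mult field_simps)
  then have "P' * q = p * Poly_Mapping.single k 1"
    by (rule alg_independent_inj[OF indep])
  then have "0 + m' = m + k"
    using lowest_mult[OF P' 1(2)] lowest_mult[OF 1(1) lowest_single[of 1 k]] lowest_unique by simp
  then have "expo m' = expo m + expo k"
    by (metis expo_add add_0)
  moreover have "expo k = \<alpha>"
    using \<alpha> by (simp add: expo_def k vec_eq_iff)
  ultimately show ?thesis
    by (simp add: 1(4))
qed

end


section \<open>Mutation of seeds\<close>

lemma exchanged_variable_eq:
  "exchanged_variable k (y, C) =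
    ((\<Prod>j\<in>UNIV. y j ^ nat (C $ j $ k)) + (\<Prod>j\<in>UNIV. y j ^ nat (- (C $ j $ k)))) / y k"
proof -
  have "(\<Prod>j | C $ j $ k > 0. y j ^ nat (C $ j $ k)) = (\<Prod>j\<in>UNIV. y j ^ nat (C $ j $ k))"
    by (rule prod.mono_neutral_left) auto
  moreover have "(\<Prod>j | C $ j $ k < 0. y j ^ nat (- (C $ j $ k))) = (\<Prod>j\<in>UNIV. y j ^ nat (- (C $ j $ k)))"
    by (rule prod.mono_neutral_left) auto
  ultimately show ?thesis by (simp add: exchanged_variable_def)
qed

lemma exchanged_variable_one_sided:
  assumes "(\<forall>j. C $ j $ k \<ge> 0) \<or> (\<forall>j. C $ j $ k \<le> 0)"
  shows "exchanged_variable k (y, C) = (1 + (\<Prod>j\<in>UNIV. y j ^ nat \<bar>C $ j $ k\<bar>)) / y k"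
  using assms by (auto simp: exchanged_variable_eq)

lemma abs_mult_symmetrized_even: "even (\<bar>a\<bar> * b + a * \<bar>b\<bar> :: int)"
  by (cases "a \<ge> 0"; cases "b \<ge> 0") (auto simp: abs_if)

lemma matrix_mutation_uminus: "matrix_mutation k (- C) = - matrix_mutation k C"
proof -
  have "(- (\<bar>a\<bar> * b) - a * \<bar>b\<bar>) div 2 = - ((\<bar>a\<bar> * b + a * \<bar>b\<bar>) div 2)" for a b :: int
  proof -
    obtain c where c: "\<bar>a\<bar> * b + a * \<bar>b\<bar> = 2 * c"
      using abs_mult_symmetrized_even[of a b] by (rule evenE)
    then have "- (\<bar>a\<bar> * b) - a * \<bar>b\<bar> = 2 * (- c)" by linarith
    then show ?thesis unfolding c by simp
  qed
  then show ?thesis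
    by (simp add: matrix_mutation_def vec_eq_iff)
qed

lemma mutation_relabel:
  assumes "bij \<sigma>"
  shows "mutation k (relabel \<sigma> s) = relabel \<sigma> (mutation (\<sigma> k) s)"
proof -
  obtain y C where s: "s = (y, C)" by fastforce
  have inj: "\<sigma> i = \<sigma> j \<longleftrightarrow> i = j" for i j
    using assms by (meson bij_is_inj injD)
  have re: "(\<Prod>j\<in>UNIV. g (\<sigma> j)) = (\<Prod>j\<in>UNIV. g j)" for g :: "'a \<Rightarrow> 'b"
    by (rule prod.reindex_bij_betw) (use assms in simp)
  have "exchanged_variable k (y \<circ> \<sigma>, \<chi> j i. C $ \<sigma> j $ \<sigma> i) = exchanged_variable (\<sigma> k) (y, C)"
    by (simp add: exchanged_variable_eq re[of "\<lambda>j. y j ^ nat (C $ j $ \<sigma> k)"]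
        re[of "\<lambda>j. y j ^ nat (- (C $ j $ \<sigma> k))"])
  then show ?thesis
    by (auto simp: mutation_def relabel_def s fun_eq_iff matrix_mutation_def vec_eq_iff inj)
qed

lemma labeled_seeds_iff:
  "s \<in> labeled_seeds \<Sigma> \<longleftrightarrow> (\<exists>s'\<in>mutation_class \<Sigma>. \<exists>\<sigma>. bij \<sigma> \<and> s = relabel \<sigma> s')"
  by (auto simp: labeled_seeds_def seeds_def seed_class_def)

lemma relabel_id: "relabel id s = s"
  by (simp add: relabel_def prod_eq_iff vec_eq_iff)

lemma mutation_class_labeled: "s \<in> mutation_class \<Sigma> \<Longrightarrow> s \<in> labeled_seeds \<Sigma>"
  unfolding labeled_seeds_iff using relabel_id[of s] bij_id by metis

lemma labeled_seeds_mutation: "s \<in> labeled_seeds \<Sigma> \<Longrightarrow> mutation k s \<in> labeled_seeds \<Sigma>"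
  unfolding labeled_seeds_iff using mutation_relabel mutation_class.mutate by metis

lemma cluster_variables_iff:
  "z \<in> cluster_variables \<Sigma> \<longleftrightarrow> (\<exists>s\<in>labeled_seeds \<Sigma>. \<exists>i. z = fst s i)"
  by (auto simp: cluster_variables_def ordered_clusters_def)

lemma cluster_variables_mutation_class:
  assumes "z \<in> cluster_variables \<Sigma>"
  obtains s i where "s \<in> mutation_class \<Sigma>" and "z = fst s i"
  using assms by (auto simp: cluster_variables_iff labeled_seeds_iff relabel_def)

lemma finite_cluster_variables:
  assumes "finite_type \<Sigma>"
  shows "finite (cluster_variables \<Sigma>)"
proof -
  have fin: "finite (seed_class s)" for s :: "('a, 'b) seed"
  proof -
    have "seed_class s \<subseteq> (\<lambda>\<sigma>. relabel \<sigma> s) ` UNIV"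
      by (auto simp: seed_class_def)
    then show ?thesis by (rule finite_subset) simp
  qed
  have "finite (labeled_seeds \<Sigma>)"
    using assms fin by (auto simp: labeled_seeds_def finite_type_def seeds_def)
  then show ?thesis
    by (auto simp: cluster_variables_def ordered_clusters_def)
qed

text \<open>A seed carries the two-form \<open>\<Sum> s\<^sub>i\<^sub>j dlog y\<^sub>i \<and> dlog y\<^sub>j\<close>, which mutation at \<open>k\<close> preserves.
  This is its shadow on initial exponents: \<open>l\<close> and \<open>m\<close> are two coordinates of them, and \<open>R\<close>
  selects the dominant monomial of the exchange relation. Both choices of \<open>R\<close> give the same
  value, since the new \<open>l\<^sub>k\<close> and \<open>m\<^sub>k\<close> for one choice and for the other differ by \<open>D \<Sum>\<^sub>i s\<^sub>i\<^sub>k l\<^sub>i\<close>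
  and \<open>D \<Sum>\<^sub>i s\<^sub>i\<^sub>k m\<^sub>i\<close>, and the contributions of these two to the form cancel.\<close>

lemma skew_form_mutation:
  fixes s s' :: "'n::finite \<Rightarrow> 'n \<Rightarrow> real"
  assumes skew: "\<And>i j. s i j = - s j i"
    and PQ: "\<And>i. P i - Q i = s i k" and Pk: "P k = 0" "Q k = 0"
    and s': "\<And>i j. s' i j = (if i = k \<or> j = k then - s i j else s i j + D * (P i * Q j - Q i * P j))"
    and R: "R = P \<or> R = Q"
    and l': "l' = l(k := - l k + D * (\<Sum>i\<in>UNIV. R i * l i))"
    and m': "m' = m(k := - m k + D * (\<Sum>i\<in>UNIV. R i * m i))"
  shows "(\<Sum>i\<in>UNIV. \<Sum>j\<in>UNIV. s' i j * l' i * m' j) = (\<Sum>i\<in>UNIV. \<Sum>j\<in>UNIV. s i j * l i * m j)"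
proof -
  define U where "U = UNIV - {k}"
  have k: "k \<notin> U" "finite U" and UNIV: "UNIV = insert k U"
    by (auto simp: U_def)
  have split: "(\<Sum>i\<in>UNIV. \<Sum>j\<in>UNIV. F i j)
      = F k k + (\<Sum>j\<in>U. F k j) + (\<Sum>i\<in>U. F i k) + (\<Sum>i\<in>U. \<Sum>j\<in>U. F i j)"
    for F :: "'n \<Rightarrow> 'n \<Rightarrow> real"
    unfolding UNIV using k by (simp add: sum.distrib)
  define Pl Ql Pm Qm where "Pl = (\<Sum>i\<in>U. P i * l i)" and "Ql = (\<Sum>i\<in>U. Q i * l i)"
    and "Pm = (\<Sum>i\<in>U. P i * m i)" and "Qm = (\<Sum>i\<in>U. Q i * m i)"
  have skk: "s k k = 0" using skew[of k k] by simp
  have Rl: "(\<Sum>i\<in>UNIV. P i * l i) = Pl" "(\<Sum>i\<in>UNIV. Q i * l i) = Ql"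
    "(\<Sum>i\<in>UNIV. P i * m i) = Pm" "(\<Sum>i\<in>UNIV. Q i * m i) = Qm"
    unfolding UNIV using k Pk by (simp_all add: Pl_def Ql_def Pm_def Qm_def)
  have ski: "s i k = P i - Q i" "s k i = Q i - P i" for i
    using PQ[of i] skew[of k i] by auto
  have row: "(\<Sum>j\<in>U. s k j * c * m j) = c * (Qm - Pm)" for c
    unfolding Qm_def Pm_def sum_subtractf[symmetric] sum_distrib_left
    by (rule sum.cong) (auto simp: ski algebra_simps)
  have col: "(\<Sum>i\<in>U. s i k * l i * c) = c * (Pl - Ql)" for c
    unfolding Ql_def Pl_def sum_subtractf[symmetric] sum_distrib_left
    by (rule sum.cong) (auto simp: ski algebra_simps)
  have inner: "(\<Sum>i\<in>U. \<Sum>j\<in>U. (s i j + D * (P i * Q j - Q i * P j)) * l i * m j)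
      = (\<Sum>i\<in>U. \<Sum>j\<in>U. s i j * l i * m j) + D * (Pl * Qm - Ql * Pm)"
  proof -
    have prod: "(\<Sum>i\<in>U. f i * l i) * (\<Sum>j\<in>U. g j * m j)
        = (\<Sum>i\<in>U. \<Sum>j\<in>U. f i * g j * l i * m j)" for f g
      unfolding sum_product by (intro sum.cong refl) (simp add: mult_ac)
    have "(s i j + D * (P i * Q j - Q i * P j)) * l i * m j
        = s i j * l i * m j + (D * (P i * Q j * l i * m j) - D * (Q i * P j * l i * m j))" for i j
      by (simp add: algebra_simps)
    then show ?thesis
      by (simp only: Pl_def Ql_def Pm_def Qm_def prod sum.distrib sum_subtractf
          sum_distrib_left[symmetric] right_diff_distrib)
  qed
  have "(\<Sum>i\<in>UNIV. \<Sum>j\<in>UNIV. s' i j * l' i * m' j)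
      = - (\<Sum>j\<in>U. s k j * l' k * m j) - (\<Sum>i\<in>U. s i k * l i * m' k)
        + (\<Sum>i\<in>U. \<Sum>j\<in>U. (s i j + D * (P i * Q j - Q i * P j)) * l i * m j)"
  proof -
    have "(\<Sum>j\<in>U. s' k j * l' k * m' j) = - (\<Sum>j\<in>U. s k j * l' k * m j)"
      unfolding sum_negf[symmetric] by (rule sum.cong) (use k in \<open>auto simp: s' m'\<close>)
    moreover have "(\<Sum>i\<in>U. s' i k * l' i * m' k) = - (\<Sum>i\<in>U. s i k * l i * m' k)"
      unfolding sum_negf[symmetric] by (rule sum.cong) (use k in \<open>auto simp: s' l'\<close>)
    moreover have "(\<Sum>i\<in>U. \<Sum>j\<in>U. s' i j * l' i * m' j)
        = (\<Sum>i\<in>U. \<Sum>j\<in>U. (s i j + D * (P i * Q j - Q i * P j)) * l i * m j)"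
      by (intro sum.cong refl) (use k in \<open>auto simp: s' l' m'\<close>)
    ultimately show ?thesis
      unfolding split by (simp add: s' skk)
  qed
  also have "\<dots> = - (l' k * (Qm - Pm)) - m' k * (Pl - Ql)
      + (\<Sum>i\<in>U. \<Sum>j\<in>U. s i j * l i * m j) + D * (Pl * Qm - Ql * Pm)"
    by (simp only: row col inner)
  also have "\<dots> = l k * (Qm - Pm) + m k * (Pl - Ql) + (\<Sum>i\<in>U. \<Sum>j\<in>U. s i j * l i * m j)"
  proof -
    have dominant: "(l' k = - l k + D * Pl \<and> m' k = - m k + D * Pm) \<or> (l' k = - l k + D * Ql \<and> m' k = - m k + D * Qm)"
      using R
    proof
      assume "R = P"
      then show ?thesis unfolding l' m' by (simp add: Rl)
    next
      assume "R = Q"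
      then show ?thesis unfolding l' m' by (simp add: Rl)
    qed
    have alg: "- ((- a + D * Pl) * (Qm - Pm)) - (- b + D * Pm) * (Pl - Ql) + c + D * (Pl * Qm - Ql * Pm)
        = a * (Qm - Pm) + b * (Pl - Ql) + c"
      "- ((- a + D * Ql) * (Qm - Pm)) - (- b + D * Qm) * (Pl - Ql) + c + D * (Pl * Qm - Ql * Pm)
        = a * (Qm - Pm) + b * (Pl - Ql) + c" for a b c :: real
      by (simp_all add: algebra_simps)
    from dominant show ?thesis
    proof (elim disjE conjE)
      assume l'k: "l' k = - l k + D * Pl" and m'k: "m' k = - m k + D * Pm"
      show ?thesis unfolding l'k m'k by (rule alg(1))
    next
      assume l'k: "l' k = - l k + D * Ql" and m'k: "m' k = - m k + D * Qm"
      show ?thesis unfolding l'k m'k by (rule alg(2))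
    qed
  qed
  also have "\<dots> = (\<Sum>i\<in>UNIV. \<Sum>j\<in>UNIV. s i j * l i * m j)"
    unfolding split row col skk by simp
  finally show ?thesis .
qed


section \<open>The bipartite seed and its two flips\<close>

locale bipartite_seed = initial_terms x w
  for x :: "'n::finite \<Rightarrow> 'f::field_char_0" and w :: "'n \<Rightarrow> real" +
  fixes B :: "int^'n^'n" and \<epsilon> :: "'n \<Rightarrow> int" and d :: "'n \<Rightarrow> int"
  assumes free: "free_generating x"
    and d_pos: "d i > 0"
    and skew: "d i * B $ i $ j = - (d j * B $ j $ i)"
    and bip: "bipartite_with \<epsilon> B"
begin

lemma sign_cases: "\<epsilon> i = 1 \<or> \<epsilon> i = -1"
  using bip by (auto simp: bipartite_with_def)

lemma B_pos_signs: "B $ j $ i > 0 \<Longrightarrow> \<epsilon> j = 1 \<and> \<epsilon> i = -1"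
  using bip by (auto simp: bipartite_with_def)

lemma skew_opposite: "B $ i $ j < 0 \<longleftrightarrow> B $ j $ i > 0"
proof -
  have "B $ i $ j < 0 \<longleftrightarrow> d i * B $ i $ j < 0"
    using d_pos[of i] by (simp add: mult_less_0_iff)
  also have "\<dots> \<longleftrightarrow> d j * B $ j $ i > 0"
    by (simp add: skew[of i j])
  also have "\<dots> \<longleftrightarrow> B $ j $ i > 0"
    using d_pos[of j] by (simp add: zero_less_mult_iff)
  finally show ?thesis .
qed

lemma B_neg_signs: "B $ j $ i < 0 \<Longrightarrow> \<epsilon> j = -1 \<and> \<epsilon> i = 1"
  using B_pos_signs[of i j] by (simp add: skew_opposite)

lemma B_same_sign: "\<epsilon> i = \<epsilon> j \<Longrightarrow> B $ i $ j = 0"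
  using B_pos_signs[of i j] B_neg_signs[of i j] by (cases "B $ i $ j" "0 :: int" rule: linorder_cases) auto

lemma column_one_sided: "(\<forall>j. B $ j $ k \<ge> 0) \<or> (\<forall>j. B $ j $ k \<le> 0)"
  using B_pos_signs[of _ k] B_neg_signs[of _ k] by (metis linorder_not_le one_neq_neg_one)

text \<open>One step along the bipartite belt: the cluster after mutation at all vertices of sign \<open>t\<close>.\<close>

definition belt :: "int \<Rightarrow> ('n \<Rightarrow> 'f) \<Rightarrow> 'n \<Rightarrow> 'f" where
  "belt t y i = (if \<epsilon> i = t then (1 + (\<Prod>j\<in>UNIV. y j ^ nat \<bar>B $ j $ i\<bar>)) / y i else y i)"

lemma initial_exponent_exchange_numerator:
  "has_initial_exponent (1 + (\<Prod>j\<in>UNIV. x j ^ e j)) 0"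
proof -
  have "has_initial_exponent (\<Prod>j\<in>UNIV. x j ^ e j) (\<Sum>j\<in>UNIV. int (e j) *s simple_root j)"
    by (intro initial_exponent_prod initial_exponent_var)
  moreover have "weight (\<Sum>j\<in>UNIV. int (e j) *s simple_root j) \<ge> 0"
    by (rule weight_nonneg) (auto simp: simple_root_def axis_def intro!: sum_nonneg)
  ultimately show ?thesis
    using initial_exponent_add[OF initial_exponent_1] by (simp add: weight_0)
qed

lemma x_nonzero: "x i \<noteq> 0"
  by (rule has_initial_exponent_nonzero[OF initial_exponent_var])

lemma exchange_numerator_nonzero: "1 + (\<Prod>j\<in>UNIV. x j ^ e j) \<noteq> 0"
  by (rule has_initial_exponent_nonzero[OF initial_exponent_exchange_numerator])

lemma belt_nonzero: "belt t x i \<noteq> 0"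
  by (simp add: belt_def x_nonzero exchange_numerator_nonzero)

text \<open>The exchange relation at \<open>i\<close> only involves variables of the opposite sign, which the step
  leaves alone, so applying the step again exchanges the same two variables back.\<close>

lemma belt_involution: "belt t (belt t x) = x"
proof
  fix i
  have "(\<Prod>j\<in>UNIV. belt t x j ^ nat \<bar>B $ j $ i\<bar>) = (\<Prod>j\<in>UNIV. x j ^ nat \<bar>B $ j $ i\<bar>)"
    if "\<epsilon> i = t"
  proof (rule prod.cong)
    fix j
    show "belt t x j ^ nat \<bar>B $ j $ i\<bar> = x j ^ nat \<bar>B $ j $ i\<bar>"
      using that B_same_sign[of j i] by (cases "\<epsilon> j = t") (auto simp: belt_def)
  qed simp
  then show "belt t (belt t x) i = x i"
    using x_nonzero[of i] exchange_numerator_nonzero[of "\<lambda>j. nat \<bar>B $ j $ i\<bar>"]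
    by (simp add: belt_def[of t "belt t x" i]) (simp add: belt_def)
qed

lemma laurent_map_belt: "laurent_map (\<lambda>y :: 'n \<Rightarrow> 'f. belt t y i)"
proof (cases "\<epsilon> i = t")
  case True
  have "laurent_map (\<lambda>y :: 'n \<Rightarrow> 'f. (1 + (\<Prod>j\<in>UNIV. y j ^ nat \<bar>B $ j $ i\<bar>)) * (1 / y i))"
    by (intro laurent_map_mult laurent_map_add laurent_map_1 laurent_map_prod laurent_map_power
        laurent_map_var laurent_map_inverse_var)
  with True show ?thesis by (simp add: belt_def)
qed (simp add: belt_def laurent_map_var)

text \<open>The automorphism of the ambient field that maps the initial cluster to the cluster one belt
  step away; it is unique because \<open>x\<close> generates the field.\<close>

definition flip :: "int \<Rightarrow> 'f \<Rightarrow> 'f" where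
  "flip t = (SOME f. field_hom f \<and> (\<forall>i. f (x i) = belt t x i))"

lemma flip_props: "field_hom (flip t) \<and> (\<forall>i. flip t (x i) = belt t x i)"
proof -
  have "alg_independent (belt t x)"
    by (rule alg_independent_laurent_involution[OF indep laurent_map_belt x_nonzero belt_nonzero
          belt_involution])
  from field_hom_extension[OF free this]
  have "\<exists>f. field_hom f \<and> (\<forall>i. f (x i) = belt t x i)" by metis
  then show ?thesis unfolding flip_def by (rule someI_ex)
qed

lemma flip_hom: "field_hom (flip t)" and flip_var: "flip t (x i) = belt t x i"
  using flip_props by auto

lemma flip_comp_x: "flip t \<circ> x = belt t x"
  by (simp add: fun_eq_iff flip_var)

lemma flip_belt: "field_hom f \<Longrightarrow> f (belt t y i) = belt t (f \<circ> y) i"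
  by (simp add: belt_def field_hom_divide field_hom_add field_hom_1 field_hom_prod field_hom_power)

lemma flip_flip: "flip t (flip t z) = z"
proof -
  have "flip t \<circ> flip t = id"
    by (rule field_hom_eq_on_generators[OF free])
      (simp_all add: flip_hom field_hom_comp, simp add: field_hom_def,
       simp add: flip_var flip_belt[OF flip_hom] flip_comp_x belt_involution)
  then show ?thesis by (metis comp_apply id_apply)
qed

text \<open>The belt step at \<open>t\<close> carries out the mutations at all vertices of sign \<open>t\<close>. They commute, as no
  two such vertices are joined by an arrow; after mutating at those in \<open>S\<close> exactly the arrows with
  an end in \<open>S\<close> are reversed.\<close>

lemma partial_flip_reachable:
  assumes "S \<subseteq> {i. \<epsilon> i = t}"
  shows "((\<lambda>i. if i \<in> S then belt t x i else x i),
      (\<chi> j i. if j \<in> S \<or> i \<in> S then - B $ j $ i else B $ j $ i)) \<in> mutation_class (x, B)"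
  using finite[of S] assms
proof (induction S rule: finite_induct)
  case empty
  have "(\<chi> j i. B $ j $ i) = B" by (simp add: vec_eq_iff)
  then show ?case by (simp add: mutation_class.initial)
next
  case (insert k S)
  define y where "y = (\<lambda>i. if i \<in> S then belt t x i else x i)"
  define C where "C = (\<chi> j i. if j \<in> S \<or> i \<in> S then - B $ j $ i else B $ j $ i)"
  have \<epsilon>k: "\<epsilon> k = t" and S: "\<And>i. i \<in> S \<Longrightarrow> \<epsilon> i = t"
    using insert.prems by auto
  have zero: "B $ j $ k = 0" "B $ k $ j = 0" if "j \<in> S" for j
    using B_same_sign S[OF that] \<epsilon>k by auto
  have col: "C $ j $ k = B $ j $ k" "C $ k $ j = B $ k $ j" for j
    using zero[of j] insert.hyps by (auto simp: C_def)
  have prod: "(\<Prod>j\<in>UNIV. y j ^ nat \<bar>B $ j $ k\<bar>) = (\<Prod>j\<in>UNIV. x j ^ nat \<bar>B $ j $ k\<bar>)"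
  proof (rule prod.cong)
    fix j show "y j ^ nat \<bar>B $ j $ k\<bar> = x j ^ nat \<bar>B $ j $ k\<bar>"
      using zero[of j] by (cases "j \<in> S") (simp_all add: y_def)
  qed simp
  have "exchanged_variable k (y, C) = (1 + (\<Prod>j\<in>UNIV. y j ^ nat \<bar>C $ j $ k\<bar>)) / y k"
    by (rule exchanged_variable_one_sided) (use column_one_sided in \<open>simp add: col\<close>)
  also have "\<dots> = belt t x k"
    using \<epsilon>k insert.hyps by (simp add: col prod belt_def) (simp add: y_def)
  finally have "y(k := exchanged_variable k (y, C)) = (\<lambda>i. if i \<in> insert k S then belt t x i else x i)"
    by (auto simp: y_def)
  moreover have "matrix_mutation k C = (\<chi> j i. if j \<in> insert k S \<or> i \<in> insert k S then - B $ j $ i else B $ j $ i)"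
  proof -
    \<comment> \<open>\<open>k\<close> is a source or a sink, so no arrows are composed through it.\<close>
    have "(\<bar>B $ j $ k\<bar> * B $ k $ i + B $ j $ k * \<bar>B $ k $ i\<bar>) div 2 = 0" for i j
    proof -
      have "B $ j $ k = 0 \<or> B $ k $ i = 0 \<or> (B $ j $ k < 0 \<and> B $ k $ i > 0) \<or> (B $ j $ k > 0 \<and> B $ k $ i < 0)"
        using B_pos_signs[of j k] B_neg_signs[of j k] B_pos_signs[of k i] B_neg_signs[of k i]
        by (metis linorder_less_linear one_neq_neg_one)
      then show ?thesis by auto
    qed
    then show ?thesis
      by (auto simp: matrix_mutation_def vec_eq_iff col) (auto simp: C_def)
  qed
  moreover have "mutation k (y, C) \<in> mutation_class (x, B)"
    using insert.IH insert.prems by (intro mutation_class.mutate) (simp add: y_def C_def)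
  ultimately show ?case by (simp add: mutation_def)
qed

lemma flip_initial_seed:
  assumes "t \<in> {1, -1}"
  shows "(flip t \<circ> x, - B) \<in> mutation_class (x, B)"
proof -
  have "(\<lambda>i. if i \<in> {i. \<epsilon> i = t} then belt t x i else x i) = flip t \<circ> x"
    by (auto simp: flip_comp_x belt_def)
  moreover have "(\<chi> j i. if j \<in> {i. \<epsilon> i = t} \<or> i \<in> {i. \<epsilon> i = t} then - B $ j $ i else B $ j $ i) = - B"
  proof -
    have "B $ j $ i = 0" if "\<epsilon> j \<noteq> t" "\<epsilon> i \<noteq> t" for i j
      using that sign_cases[of i] sign_cases[of j] assms by (intro B_same_sign) auto
    then show ?thesis by (auto simp: vec_eq_iff)
  qed
  ultimately show ?thesis using partial_flip_reachable[of "{i. \<epsilon> i = t}" t] by simp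
qed

text \<open>The exchange relations of a seed do not change when its matrix is negated, so a field
  automorphism may be combined with a change of sign.\<close>

lemma flip_mutation:
  "mutation k (flip t \<circ> y, - C) = (flip t \<circ> fst (mutation k (y, C)), - snd (mutation k (y, C)))"
  by (auto simp: mutation_def matrix_mutation_uminus exchanged_variable_eq fun_eq_iff
      field_hom_divide[OF flip_hom] field_hom_add[OF flip_hom] field_hom_prod[OF flip_hom]
      field_hom_power[OF flip_hom] add.commute)

lemma flip_mutation_class:
  assumes "t \<in> {1, -1}"
  shows "s \<in> mutation_class (x, B) \<Longrightarrow> (flip t \<circ> fst s, - snd s) \<in> mutation_class (x, B)"
proof (induction s rule: mutation_class.induct)
  case initial
  then show ?case using flip_initial_seed[OF assms] by (simp add: comp_def)
next
  case (mutate s k)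
  then have "mutation k (flip t \<circ> fst s, - snd s) \<in> mutation_class (x, B)"
    by (intro mutation_class.mutate)
  then show ?case unfolding flip_mutation prod.collapse .
qed

lemma flip_labeled_seeds:
  assumes t: "t \<in> {1, -1}" and "(y, C) \<in> labeled_seeds (x, B)"
  shows "(flip t \<circ> y, - C) \<in> labeled_seeds (x, B)"
proof -
  obtain s \<sigma> where s: "s \<in> mutation_class (x, B)" "bij \<sigma>" "(y, C) = relabel \<sigma> s"
    using assms(2) by (auto simp: labeled_seeds_iff)
  have "(flip t \<circ> y, - C) = relabel \<sigma> (flip t \<circ> fst s, - snd s)"
    using s(3) by (auto simp: relabel_def vec_eq_iff)
  with flip_mutation_class[OF t s(1)] s(2) show ?thesis
    by (auto simp: labeled_seeds_iff)
qed

lemma flip_cluster_variables: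
  assumes t: "t \<in> {1, -1}" and "z \<in> cluster_variables (x, B)"
  shows "flip t z \<in> cluster_variables (x, B)"
proof -
  obtain y C i where "(y, C) \<in> labeled_seeds (x, B)" "z = y i"
    using assms(2) by (auto simp: cluster_variables_iff)
  with flip_labeled_seeds[OF t, of y C] show ?thesis
    by (force simp: cluster_variables_iff)
qed

lemma flip_algebra:
  assumes t: "t \<in> {1, -1}" and "z \<in> cluster_algebra (x, B)"
  shows "flip t z \<in> cluster_algebra (x, B)"
  using assms(2) unfolding cluster_algebra_def
proof (induction z rule: Z_subalgebra.induct)
  case (gen g)
  then show ?case by (intro Z_subalgebra.gen flip_cluster_variables[OF t])
qed (simp_all add: field_hom_1[OF flip_hom] field_hom_diff[OF flip_hom] field_hom_mult[OF flip_hom]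
    Z_subalgebra.intros)

lemma flip_automorphism:
  assumes t: "t \<in> {1, -1}"
  shows "Z_algebra_automorphism (cluster_algebra (x, B)) (flip t)"
proof -
  have "bij_betw (flip t) (cluster_algebra (x, B)) (cluster_algebra (x, B))"
    by (rule bij_betw_byWitness[where f' = "flip t"]) (auto simp: flip_flip flip_algebra[OF t])
  then show ?thesis
    by (simp add: Z_algebra_automorphism_def field_homD[OF flip_hom])
qed

text \<open>Along mutations every variable stays subtraction-free, its initial exponent changes by the
  dominant monomial of the exchange relation, and the two-form of the seed is preserved.\<close>

definition tame_seed :: "('n, 'f) seed \<Rightarrow> bool" where
  "tame_seed s \<longleftrightarrow> (\<forall>i j. d i * snd s $ i $ j = - (d j * snd s $ j $ i)) \<and>
     (\<exists>g. (\<forall>i. has_initial_exponent (fst s i) (g i)) \<and>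
       (\<forall>a b. (\<Sum>i\<in>UNIV. \<Sum>j\<in>UNIV.
            real_of_int (snd s $ i $ j) / real_of_int (d j) * real_of_int (g i $ a) * real_of_int (g j $ b))
          = real_of_int (B $ a $ b) / real_of_int (d b)))"

lemma tame_seedE:
  assumes "tame_seed (y, C)"
  obtains g where "\<And>i j. d i * C $ i $ j = - (d j * C $ j $ i)"
    and "\<And>i. has_initial_exponent (y i) (g i)"
    and "\<And>a b. (\<Sum>i\<in>UNIV. \<Sum>j\<in>UNIV.
        real_of_int (C $ i $ j) / real_of_int (d j) * real_of_int (g i $ a) * real_of_int (g j $ b))
      = real_of_int (B $ a $ b) / real_of_int (d b)"
  using assms unfolding tame_seed_def fst_conv snd_conv by blast

lemma double_sum_simple_root:
  fixes F :: "'n \<Rightarrow> 'n \<Rightarrow> real"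
  shows "(\<Sum>i\<in>UNIV. \<Sum>j\<in>UNIV. F i j * real_of_int (simple_root i $ a) * real_of_int (simple_root j $ b)) = F a b"
proof -
  have "(\<Sum>j\<in>UNIV. F i j * c * real_of_int (simple_root j $ b)) = F i b * c" for i c
  proof -
    have "(\<Sum>j\<in>UNIV. F i j * c * real_of_int (simple_root j $ b)) = (\<Sum>j\<in>UNIV. if j = b then F i b * c else 0)"
      by (rule sum.cong) (auto simp: simple_root_nth)
    then show ?thesis by simp
  qed
  then have "(\<Sum>i\<in>UNIV. \<Sum>j\<in>UNIV. F i j * real_of_int (simple_root i $ a) * real_of_int (simple_root j $ b))
      = (\<Sum>i\<in>UNIV. F i b * real_of_int (simple_root i $ a))" by simp
  also have "\<dots> = (\<Sum>i\<in>UNIV. if i = a then F a b else 0)"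
    by (rule sum.cong) (auto simp: simple_root_nth)
  finally show ?thesis by simp
qed

lemma tame_initial: "tame_seed (x, B)"
  unfolding tame_seed_def fst_conv snd_conv
  using skew initial_exponent_var
    double_sum_simple_root[of "\<lambda>i j. real_of_int (B $ i $ j) / real_of_int (d j)"]
  by blast

lemma tame_mutation:
  assumes "tame_seed s"
  shows "tame_seed (mutation k s)"
proof -
  obtain y C where s_eq: "s = (y, C)" by fastforce
  from assms[unfolded s_eq] obtain g where skewC: "\<And>i j. d i * C $ i $ j = - (d j * C $ j $ i)"
    and g: "\<And>i. has_initial_exponent (y i) (g i)"
    and form: "\<And>a b. (\<Sum>i\<in>UNIV. \<Sum>j\<in>UNIV.
        real_of_int (C $ i $ j) / real_of_int (d j) * real_of_int (g i $ a) * real_of_int (g j $ b))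
      = real_of_int (B $ a $ b) / real_of_int (d b)"
    by (rule tame_seedE) (rule that)
  define C' where "C' = matrix_mutation k C"
  define q q' where "q i j = real_of_int (C $ i $ j) / real_of_int (d j)"
    and "q' i j = real_of_int (C' $ i $ j) / real_of_int (d j)" for i j
  define P Q where "P i = max (q i k) 0" and "Q i = max (- q i k) 0" for i
  have d: "real_of_int (d i) > 0" for i using d_pos[of i] by simp
  have q_skew: "q i j = - q j i" for i j
  proof -
    have "real_of_int (d i * C $ i $ j) = - real_of_int (d j * C $ j $ i)"
      using skewC[of i j] by simp
    then show ?thesis
      using d[of i] d[of j] by (simp add: q_def field_simps)
  qed
  have q': "q' i j = (if i = k \<or> j = k then - q i j else q i j + real_of_int (d k) * (P i * Q j - Q i * P j))"
    for i j
  proof (cases "i = k \<or> j = k")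
    case False
    let ?e = "\<bar>C $ i $ k\<bar> * C $ k $ j + C $ i $ k * \<bar>C $ k $ j\<bar>"
    obtain c where c: "?e = 2 * c"
      using abs_mult_symmetrized_even by (rule evenE)
    have "C' $ i $ j = C $ i $ j + c"
      using False c by (simp add: C'_def matrix_mutation_def)
    then have "q' i j = q i j + real_of_int ?e / 2 / real_of_int (d j)"
      unfolding c by (simp add: q'_def q_def add_divide_distrib)
    also have "real_of_int ?e = \<bar>q i k * d k\<bar> * (q k j * d j) + q i k * d k * \<bar>q k j * d j\<bar>"
      using d[of k] d[of j] by (simp add: q_def)
    also have "\<dots> = (\<bar>q i k\<bar> * q k j + q i k * \<bar>q k j\<bar>) * d k * d j"
      using d[of k] d[of j] by (simp add: abs_mult algebra_simps)
    also have "\<bar>q i k\<bar> * q k j + q i k * \<bar>q k j\<bar> = 2 * (P i * Q j - Q i * P j)"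
      by (auto simp: P_def Q_def q_skew[of k j] max_def abs_if)
    finally show ?thesis
      using False d[of j] by simp
  qed (auto simp: q'_def q_def C'_def matrix_mutation_def)
  have PQ: "P i - Q i = q i k" for i by (simp add: P_def Q_def)
  have skk: "q k k = 0" using q_skew[of k k] by simp
  then have Pk: "P k = 0" "Q k = 0" by (simp_all add: P_def Q_def)
  have q'_skew: "q' i j = - q' j i" for i j
    using q_skew[of i j] by (auto simp: q' algebra_simps)
  have "d i * C' $ i $ j = - (d j * C' $ j $ i)" for i j
  proof -
    have "real_of_int (d i * C' $ i $ j) = real_of_int (- (d j * C' $ j $ i))"
      using q'_skew[of i j] d[of i] d[of j] by (simp add: q'_def field_simps)
    then show ?thesis by (simp only: of_int_eq_iff)
  qed
  moreover
  define L where "L e = (\<Sum>i\<in>UNIV. int (nat (e i)) *s g i)" for e :: "'n \<Rightarrow> int"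
  have mono: "has_initial_exponent (\<Prod>i\<in>UNIV. y i ^ nat (e i)) (L e)" for e
    unfolding L_def by (intro initial_exponent_prod g)
  let ?p = "\<lambda>i. C $ i $ k" and ?q = "\<lambda>i. - C $ i $ k"
  \<comment> \<open>\<open>R\<close> records which of the two monomials of the exchange relation is the lighter one.\<close>
  obtain e R where R: "R = P \<or> R = Q" and Re: "\<And>i. real_of_int (d k) * R i = real (nat (e i))"
    and num: "has_initial_exponent ((\<Prod>i\<in>UNIV. y i ^ nat (?p i)) + (\<Prod>i\<in>UNIV. y i ^ nat (?q i))) (L e)"
  proof -
    have P: "real_of_int (d k) * P i = real (nat (?p i))" and Q: "real_of_int (d k) * Q i = real (nat (?q i))" for i
      using d[of k] by (auto simp: P_def Q_def q_def max_def field_simps)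
    show ?thesis
    proof (cases "weight (L ?p) \<le> weight (L ?q)")
      case True
      show ?thesis
        by (rule that[of P ?p]) (use P initial_exponent_add[OF mono mono True] in auto)
    next
      case False
      then show ?thesis
        by (intro that[of Q ?q])
          (use Q initial_exponent_add[OF mono mono, of ?q ?p] in \<open>auto simp: add.commute\<close>)
    qed
  qed
  define g' where "g' = g(k := L e - g k)"
  have "has_initial_exponent (fst (mutation k (y, C)) i) (g' i)" for i
    using g initial_exponent_divide[OF num g[of k]]
    by (simp add: mutation_def exchanged_variable_eq g'_def)
  moreover have "(\<Sum>i\<in>UNIV. \<Sum>j\<in>UNIV. q' i j * real_of_int (g' i $ a) * real_of_int (g' j $ b))
      = real_of_int (B $ a $ b) / real_of_int (d b)" for a b
  proof -
    have g'_coord: "(\<lambda>i. real_of_int (g' i $ a)) = (\<lambda>i. real_of_int (g i $ a))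
        (k := - real_of_int (g k $ a) + real_of_int (d k) * (\<Sum>i\<in>UNIV. R i * real_of_int (g i $ a)))" for a
    proof -
      have "real_of_int (L e $ a) = (\<Sum>i\<in>UNIV. real_of_int (d k) * R i * real_of_int (g i $ a))"
        by (auto simp: L_def Re intro!: sum.cong)
      then show ?thesis
        by (auto simp: g'_def fun_eq_iff sum_distrib_left mult.assoc)
    qed
    show ?thesis
      unfolding form[symmetric] q_def[symmetric]
      by (rule skew_form_mutation[where l' = "\<lambda>i. real_of_int (g' i $ a)" and m' = "\<lambda>i. real_of_int (g' i $ b)"
            and s' = q' and s = q, OF q_skew PQ Pk q' R g'_coord g'_coord])
  qed
  ultimately show ?thesis
    unfolding tame_seed_def s_eq q'_def C'_def mutation_def fst_conv snd_conv by blast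
qed

lemma tame_mutation_class: "s \<in> mutation_class (x, B) \<Longrightarrow> tame_seed s"
  by (induction s rule: mutation_class.induct) (auto intro: tame_initial tame_mutation)

lemma initial_exponent_cluster_variable:
  assumes "z \<in> cluster_variables (x, B)"
  shows "\<exists>g. has_initial_exponent z g"
proof -
  obtain s i where "s \<in> mutation_class (x, B)" and z: "z = fst s i"
    using assms by (rule cluster_variables_mutation_class)
  then have "tame_seed s" by (intro tame_mutation_class)
  then show ?thesis unfolding z tame_seed_def by blast
qed

text \<open>The matrix \<open>-B\<close> defines the same exchange relations as \<open>B\<close>, so only an invariant that sees
  signs can exclude it. The two-form does: on a seed with cluster \<open>x\<close> its coefficients are the
  matrix entries up to positive factors, and it equals the two-form of \<open>B\<close>.\<close>

lemma matrix_sign_on_initial_cluster: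
  assumes "(x, C) \<in> labeled_seeds (x, B)"
  shows "sgn (C $ a $ b) = sgn (B $ a $ b)"
proof -
  obtain y D \<sigma> where yD: "(y, D) \<in> mutation_class (x, B)" and \<sigma>: "bij \<sigma>" and "(x, C) = relabel \<sigma> (y, D)"
    using assms by (auto simp: labeled_seeds_iff)
  then have x: "\<And>i. x i = y (\<sigma> i)" and C: "\<And>i j. C $ i $ j = D $ \<sigma> i $ \<sigma> j"
    by (auto simp: relabel_def)
  from tame_mutation_class[OF yD] obtain g where g: "\<And>i. has_initial_exponent (y i) (g i)"
    and form: "\<And>a b. (\<Sum>i\<in>UNIV. \<Sum>j\<in>UNIV.
        real_of_int (D $ i $ j) / real_of_int (d j) * real_of_int (g i $ a) * real_of_int (g j $ b))
      = real_of_int (B $ a $ b) / real_of_int (d b)"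
    by (rule tame_seedE) (rule that)
  have g\<sigma>: "g (\<sigma> i) = simple_root i" for i
    using initial_exponent_unique[OF g[of "\<sigma> i"]] initial_exponent_var[of i] by (simp add: x)
  have reindex: "(\<Sum>i\<in>UNIV. h i) = (\<Sum>i\<in>UNIV. h (\<sigma> i))" for h :: "'n \<Rightarrow> real"
    using sum.reindex_bij_betw[of \<sigma> UNIV UNIV h] \<sigma> by simp
  have "real_of_int (B $ a $ b) / real_of_int (d b) = (\<Sum>i\<in>UNIV. \<Sum>j\<in>UNIV.
      real_of_int (C $ i $ j) / real_of_int (d (\<sigma> j)) * real_of_int (simple_root i $ a) * real_of_int (simple_root j $ b))"
    unfolding form[symmetric] C g\<sigma>[symmetric]
    by (subst reindex) (rule sum.cong[OF refl], rule reindex)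
  also have "\<dots> = real_of_int (C $ a $ b) / real_of_int (d (\<sigma> b))"
    by (rule double_sum_simple_root)
  finally have eq: "real_of_int (B $ a $ b) / real_of_int (d b) = real_of_int (C $ a $ b) / real_of_int (d (\<sigma> b))" .
  have "sgn (real_of_int m / real_of_int (d i)) = real_of_int (sgn m)" for m i
    using d_pos[of i] by (simp add: sgn_if zero_less_divide_iff)
  then have "real_of_int (sgn (B $ a $ b)) = real_of_int (sgn (C $ a $ b))"
    using arg_cong[OF eq, of sgn] by simp
  then show ?thesis by (simp only: of_int_eq_iff)
qed

text \<open>Initial exponents read off denominator vectors, since \<open>x\<^sub>\<alpha>\<close> has a numerator with nonzero
  constant term.\<close>

lemma initial_exponent_denominator_bijection:
  assumes X: "denominator_bijection (x, B) X"
    and \<alpha>: "\<alpha> \<in> almost_positive_roots (cartan_counterpart B)"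
  shows "has_initial_exponent (X \<alpha>) (- \<alpha>)"
proof (cases "\<alpha> \<in> positive_roots (cartan_counterpart B)")
  case True
  have "X \<alpha> \<in> cluster_variables (x, B)"
    using X \<alpha> by (auto simp: denominator_bijection_def bij_betw_def)
  then obtain g where g: "has_initial_exponent (X \<alpha>) g"
    using initial_exponent_cluster_variable by blast
  obtain P :: "('n \<Rightarrow>\<^sub>0 nat) \<Rightarrow>\<^sub>0 int" where "Poly_Mapping.lookup P 0 \<noteq> 0"
      "X \<alpha> = poly_eval of_int x P / (\<Prod>j\<in>UNIV. x j ^ nat (\<alpha> $ j))"
    using X True by (auto simp: denominator_bijection_def)
  with g have "g = - \<alpha>"
    by (rule initial_exponent_denominator) (use True in \<open>simp add: positive_roots_def\<close>)
  with g show ?thesis by simp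
next
  case False
  then obtain i where "\<alpha> = - simple_root i"
    using \<alpha> by (auto simp: almost_positive_roots_def)
  then show ?thesis
    using X initial_exponent_var[of i] by (auto simp: denominator_bijection_def)
qed

lemma cluster_variable_of_exponent:
  assumes X: "denominator_bijection (x, B) X"
    and z: "z \<in> cluster_variables (x, B)" and g: "has_initial_exponent z (- \<beta>)"
  shows "z = X \<beta>"
proof -
  obtain \<gamma> where \<gamma>: "\<gamma> \<in> almost_positive_roots (cartan_counterpart B)" "z = X \<gamma>"
    using X z unfolding denominator_bijection_def bij_betw_def by fastforce
  then have "- \<beta> = - \<gamma>"
    using initial_exponent_unique g initial_exponent_denominator_bijection[OF X \<gamma>(1)] by blast
  with \<gamma> show ?thesis by simp
qed

text \<open>The columns of \<open>C\<close> have constant sign because those of \<open>B\<close> do. So every exchange relation of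
  the seed has a trivial monomial, so the variable exchanged for \<open>x\<^sub>k\<close> has initial exponent
  \<open>-\<alpha>\<^sub>k\<close>. Hence it is the variable that \<open>B\<close> exchanges for \<open>x\<^sub>k\<close>, and the exchange relations agree.\<close>

lemma matrix_of_initial_cluster:
  assumes X: "denominator_bijection (x, B) X" and C: "(x, C) \<in> labeled_seeds (x, B)"
  shows "C = B"
proof -
  have exch: "exchanged_variable k (x, D) = (1 + (\<Prod>j\<in>UNIV. x j ^ nat \<bar>D $ j $ k\<bar>)) / x k
      \<and> exchanged_variable k (x, D) = X (simple_root k)"
    if D: "(x, D) \<in> labeled_seeds (x, B)" for D k
  proof -
    have "D $ j $ k \<ge> 0 \<longleftrightarrow> B $ j $ k \<ge> 0" "D $ j $ k \<le> 0 \<longleftrightarrow> B $ j $ k \<le> 0" for j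
      using matrix_sign_on_initial_cluster[OF D, of j k] by (auto simp: sgn_if split: if_splits)
    then have "(\<forall>j. D $ j $ k \<ge> 0) \<or> (\<forall>j. D $ j $ k \<le> 0)"
      using column_one_sided[of k] by simp
    then have eq: "exchanged_variable k (x, D) = (1 + (\<Prod>j\<in>UNIV. x j ^ nat \<bar>D $ j $ k\<bar>)) / x k"
      by (rule exchanged_variable_one_sided)
    have "has_initial_exponent (exchanged_variable k (x, D)) (- simple_root k)"
      using initial_exponent_divide[OF initial_exponent_exchange_numerator initial_exponent_var]
      by (simp add: eq)
    moreover have "exchanged_variable k (x, D) \<in> cluster_variables (x, B)"
      using labeled_seeds_mutation[OF D, of k]
      by (auto simp: cluster_variables_iff mutation_def intro!: bexI exI[of _ k])
    ultimately show ?thesis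
      using eq cluster_variable_of_exponent[OF X] by blast
  qed
  have B: "(x, B) \<in> labeled_seeds (x, B)"
    by (intro mutation_class_labeled mutation_class.initial)
  have coord: "(\<Sum>i\<in>UNIV. int (e i) *s simple_root i) $ j = int (e j)" for e :: "'n \<Rightarrow> nat" and j
  proof -
    have "(\<Sum>i\<in>UNIV. int (e i) *s simple_root i) $ j = (\<Sum>i\<in>UNIV. if i = j then int (e j) else 0)"
      unfolding sum_component by (rule sum.cong) (auto simp: simple_root_nth)
    then show ?thesis by simp
  qed
  have abs: "\<bar>C $ j $ k\<bar> = \<bar>B $ j $ k\<bar>" for j k
  proof -
    have "(1 + (\<Prod>j\<in>UNIV. x j ^ nat \<bar>C $ j $ k\<bar>)) / x k = (1 + (\<Prod>j\<in>UNIV. x j ^ nat \<bar>B $ j $ k\<bar>)) / x k"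
      using exch[OF C, of k] exch[OF B, of k] by metis
    then have eq: "(\<Prod>j\<in>UNIV. x j ^ nat \<bar>C $ j $ k\<bar>) = (\<Prod>j\<in>UNIV. x j ^ nat \<bar>B $ j $ k\<bar>)"
      using x_nonzero[of k] by simp
    have mono: "has_initial_exponent (\<Prod>j\<in>UNIV. x j ^ e j) (\<Sum>j\<in>UNIV. int (e j) *s simple_root j)" for e
      by (intro initial_exponent_prod initial_exponent_var)
    have "(\<Sum>j\<in>UNIV. int (nat \<bar>C $ j $ k\<bar>) *s simple_root j)
        = (\<Sum>j\<in>UNIV. int (nat \<bar>B $ j $ k\<bar>) *s (simple_root j :: int^'n))"
      by (rule initial_exponent_unique[OF mono[of "\<lambda>j. nat \<bar>C $ j $ k\<bar>", unfolded eq] mono])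
    from arg_cong[OF this, of "\<lambda>v. v $ j"] have "int (nat \<bar>C $ j $ k\<bar>) = int (nat \<bar>B $ j $ k\<bar>)"
      by (simp only: coord)
    then show ?thesis by simp
  qed
  have "C $ j $ k = B $ j $ k" for j k
    using abs[of j k] matrix_sign_on_initial_cluster[OF C, of j k] by (metis sgn_mult_abs)
  then show ?thesis by (simp add: vec_eq_iff)
qed

lemma exchange_matrix_initial:
  assumes "denominator_bijection (x, B) X"
  shows "exchange_matrix (x, B) x = B"
  unfolding exchange_matrix_def
  by (rule the_equality)
    (use matrix_of_initial_cluster[OF assms] in
      \<open>auto intro: mutation_class_labeled mutation_class.initial\<close>)

lemma exchange_matrix_flip:
  assumes "denominator_bijection (x, B) X" and t: "t \<in> {1, -1}"
  shows "exchange_matrix (x, B) (flip t \<circ> x) = - B"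
  unfolding exchange_matrix_def
proof (rule the_equality)
  show "(flip t \<circ> x, - B) \<in> labeled_seeds (x, B)"
    by (intro mutation_class_labeled flip_initial_seed t)
  fix C assume "(flip t \<circ> x, C) \<in> labeled_seeds (x, B)"
  from flip_labeled_seeds[OF t this] have "(x, - C) \<in> labeled_seeds (x, B)"
    by (simp add: comp_def flip_flip)
  with matrix_of_initial_cluster[OF assms(1)] show "C = - B" by fastforce
qed

lemma flip_ordered_cluster: "t \<in> {1, -1} \<Longrightarrow> flip t \<circ> x \<in> ordered_clusters (x, B)"
  using mutation_class_labeled[OF flip_initial_seed] by (force simp: ordered_clusters_def)

text \<open>The initial seed itself witnesses compatibility with mutation.\<close>

lemma flip_inverse_cluster_automorphism:
  assumes X: "denominator_bijection (x, B) X" and t: "t \<in> {1, -1}"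
  shows "cluster_automorphism (x, B) (flip t)" and "inverse_cluster_automorphism (x, B) (flip t)"
proof -
  have "flip t (cluster_mutation (x, B) x k i) = cluster_mutation (x, B) (flip t \<circ> x) k i" for k i
    unfolding cluster_mutation_def exchange_matrix_initial[OF X] exchange_matrix_flip[OF X t]
      flip_mutation by simp
  then have "mutation_compatible (x, B) (flip t) x"
    using flip_ordered_cluster[OF t] by (simp add: mutation_compatible_def)
  moreover have "(x, B) \<in> labeled_seeds (x, B)"
    by (intro mutation_class_labeled mutation_class.initial)
  ultimately show "cluster_automorphism (x, B) (flip t)" "inverse_cluster_automorphism (x, B) (flip t)"
    using flip_automorphism[OF t] exchange_matrix_flip[OF X t]
    unfolding cluster_automorphism_def inverse_cluster_automorphism_def by auto
qed

end


section \<open>Root vectors of a bipartite Cartan matrix\<close>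

text \<open>Entries off the diagonal pair up.\<close>

lemma sum_symmetric_even:
  fixes M :: "'a \<Rightarrow> 'a \<Rightarrow> int"
  assumes "finite S" and "\<And>a b. M a b = M b a" and "\<And>a. even (M a a)"
  shows "even (\<Sum>a\<in>S. \<Sum>b\<in>S. M a b)"
  using assms(1)
proof (induction S rule: finite_induct)
  case (insert k S)
  have "(\<Sum>a\<in>S. M a k) = (\<Sum>a\<in>S. M k a)"
    by (intro sum.cong refl assms(2))
  then have "(\<Sum>a\<in>insert k S. \<Sum>b\<in>insert k S. M a b)
      = M k k + 2 * (\<Sum>b\<in>S. M k b) + (\<Sum>a\<in>S. \<Sum>b\<in>S. M a b)"
    using insert.hyps by (simp add: sum.distrib)
  then show ?case using insert.IH assms(3) by simp
qed simp

definition nonneg_vec :: "int^'n \<Rightarrow> bool" where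
  "nonneg_vec v \<longleftrightarrow> (\<forall>j. v $ j \<ge> 0)"

text \<open>Finiteness of the set of roots is an assumption here: in a cluster algebra of finite type it
  is inherited from the set of cluster variables.\<close>

locale bipartite_cartan =
  fixes A :: "int^'n::finite^'n" and \<epsilon> :: "'n \<Rightarrow> int" and e :: "'n \<Rightarrow> int"
  assumes diag: "A $ i $ i = 2"
    and off_diag: "i \<noteq> j \<Longrightarrow> A $ i $ j \<le> 0"
    and e_pos: "e i > 0"
    and sym: "e i * A $ i $ j = e j * A $ j $ i"
    and posdef: "v \<noteq> 0 \<Longrightarrow> (\<Sum>i\<in>UNIV. \<Sum>j\<in>UNIV. e i * A $ i $ j * v $ i * v $ j) > 0"
    and signs: "\<epsilon> i = 1 \<or> \<epsilon> i = -1"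
    and same_sign: "i \<noteq> j \<Longrightarrow> \<epsilon> i = \<epsilon> j \<Longrightarrow> A $ i $ j = 0"
    and connected: "S \<noteq> {} \<Longrightarrow> (\<And>i j. i \<in> S \<Longrightarrow> A $ j $ i \<noteq> 0 \<Longrightarrow> j \<in> S) \<Longrightarrow> S = UNIV"
    and finite_roots: "finite (positive_roots A)"
begin

definition form :: "int^'n \<Rightarrow> int^'n \<Rightarrow> int" where
  "form u v = (\<Sum>i\<in>UNIV. \<Sum>j\<in>UNIV. e i * A $ i $ j * u $ i * v $ j)"

lemma form_add_left: "form (u + v) z = form u z + form v z"
  by (simp add: form_def distrib_right distrib_left sum.distrib)

lemma form_scale_left: "form (c *s u) z = c * form u z"
  by (simp add: form_def sum_distrib_left mult_ac)

lemma form_sym: "form u v = form v u"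
proof -
  have "form v u = (\<Sum>j\<in>UNIV. \<Sum>i\<in>UNIV. e j * A $ j $ i * v $ j * u $ i)"
    by (simp add: form_def)
  also have "\<dots> = (\<Sum>i\<in>UNIV. \<Sum>j\<in>UNIV. e j * A $ j $ i * v $ j * u $ i)"
    by (rule sum.swap)
  also have "\<dots> = form u v"
    unfolding form_def by (intro sum.cong refl) (simp add: sym[symmetric] mult_ac)
  finally show ?thesis by simp
qed

lemma form_diff_left: "form (u - v) z = form u z - form v z"
  using form_add_left[of "u - v" v z] by simp

lemma form_diff_right: "form z (u - v) = form z u - form z v"
  by (simp add: form_sym[of z] form_diff_left)

lemma form_scale_right: "form z (c *s u) = c * form z u"
  by (simp add: form_sym[of z] form_scale_left)

lemma form_pos: "v \<noteq> 0 \<Longrightarrow> form v v > 0"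
  by (simp add: form_def posdef)

lemma form_simple_root: "form (simple_root k) v = e k * (\<Sum>l\<in>UNIV. A $ k $ l * v $ l)"
proof -
  have "form (simple_root k) v = (\<Sum>i\<in>UNIV. if i = k then \<Sum>j\<in>UNIV. e k * A $ k $ j * v $ j else 0)"
    unfolding form_def by (rule sum.cong) (auto simp: simple_root_nth)
  then show ?thesis by (simp add: sum_distrib_left mult_ac)
qed

text \<open>The two properties of a root in the orbit of \<open>\<alpha>\<^sub>i\<close> from which sign coherence will follow: its
  norm, and the integrality of the coefficients \<open>e\<^sub>j \<beta>\<^sub>j / e\<^sub>i\<close> of its coroot in the simple coroots.\<close>

definition root_like :: "int^'n \<Rightarrow> bool" where
  "root_like \<beta> \<longleftrightarrow> (\<exists>i. form \<beta> \<beta> = 2 * e i \<and> (\<forall>j. e i dvd e j * \<beta> $ j))"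

lemma simple_reflection_eq:
  "simple_reflection A k \<alpha> = \<alpha> - (\<Sum>l\<in>UNIV. A $ k $ l * \<alpha> $ l) *s simple_root k"
  by (simp add: simple_reflection_def vec_eq_iff mult.commute)

lemma sum_A_simple_root: "(\<Sum>l\<in>UNIV. A $ k $ l * simple_root i $ l) = A $ k $ i"
proof -
  have "(\<Sum>l\<in>UNIV. A $ k $ l * simple_root i $ l) = (\<Sum>l\<in>UNIV. if l = i then A $ k $ i else 0)"
    by (rule sum.cong) (auto simp: simple_root_nth)
  then show ?thesis by simp
qed

lemma root_like_simple: "root_like (simple_root i)"
  unfolding root_like_def
proof (rule exI[of _ i], intro conjI allI)
  show "form (simple_root i) (simple_root i) = 2 * e i"
    by (simp add: form_simple_root sum_A_simple_root diag)
  show "e i dvd e j * simple_root i $ j" for j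
    by (simp add: simple_root_nth)
qed

lemma root_like_reflection:
  assumes "root_like \<alpha>"
  shows "root_like (simple_reflection A k \<alpha>)"
proof -
  obtain i where i: "form \<alpha> \<alpha> = 2 * e i" "\<And>j. e i dvd e j * \<alpha> $ j"
    using assms by (auto simp: root_like_def)
  define c where "c = (\<Sum>l\<in>UNIV. A $ k $ l * \<alpha> $ l)"
  have k: "form (simple_root k) \<alpha> = e k * c" "form \<alpha> (simple_root k) = e k * c"
      "form (simple_root k) (simple_root k) = e k * 2"
    by (simp_all add: form_sym[of \<alpha>] form_simple_root c_def sum_A_simple_root diag)
  have "form (\<alpha> - c *s simple_root k) (\<alpha> - c *s simple_root k) = 2 * e i"
    by (simp add: form_diff_left form_diff_right form_scale_left form_scale_right k i algebra_simps)
  moreover have "e i dvd e j * (\<alpha> - c *s simple_root k) $ j" for j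
  proof (cases "j = k")
    case True
    have "e k * c = (\<Sum>l\<in>UNIV. A $ l $ k * (e l * \<alpha> $ l))"
      unfolding c_def sum_distrib_left
    proof (rule sum.cong)
      fix l show "e k * (A $ k $ l * \<alpha> $ l) = A $ l $ k * (e l * \<alpha> $ l)"
        using sym[of k l] by (metis mult.assoc mult.commute)
    qed simp
    then have "e i dvd e k * c"
      using i(2) by (auto intro: dvd_sum)
    then show ?thesis
      using True i(2)[of k] by (simp add: simple_root_nth right_diff_distrib)
  next
    case False
    then show ?thesis using i(2)[of j] by (simp add: simple_root_nth)
  qed
  ultimately show ?thesis
    unfolding root_like_def simple_reflection_eq c_def[symmetric] by blast
qed

lemma root_like_roots: "\<alpha> \<in> roots A \<Longrightarrow> root_like \<alpha>"
  by (induction \<alpha> rule: roots.induct) (auto intro: root_like_simple root_like_reflection)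

lemma root_like_nonzero: "root_like \<beta> \<Longrightarrow> \<beta> \<noteq> 0"
proof
  assume "root_like \<beta>" "\<beta> = 0"
  then obtain i where "form 0 0 = 2 * e i" by (auto simp: root_like_def)
  then show False using e_pos[of i] by (simp add: form_def)
qed

text \<open>Writing \<open>e\<^sub>j v\<^sub>j = e\<^sub>i c\<^sub>j\<close>, the form is \<open>e\<^sub>i\<close> times the sum of the symmetric integer matrix
  \<open>c\<^sub>a A\<^sub>a\<^sub>b v\<^sub>b\<close>, whose diagonal is even.\<close>

lemma form_dvd:
  assumes "\<And>j. e i dvd e j * v $ j"
  shows "2 * e i dvd form v v"
proof -
  obtain c where c: "\<And>j. e j * v $ j = e i * c j"
    using assms unfolding dvd_def by metis
  have term_eq: "e a * A $ a $ b * v $ a * v $ b = e i * (c a * A $ a $ b * v $ b)" for a b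
    using c[of a] by (metis mult.assoc mult.commute)
  have "c a * A $ a $ b * v $ b = c b * A $ b $ a * v $ a" for a b
  proof -
    have "e i * (c a * A $ a $ b * v $ b) = e i * (c b * A $ b $ a * v $ a)"
      unfolding term_eq[symmetric] by (simp add: sym[of a b] mult_ac)
    then show ?thesis using e_pos[of i] by simp
  qed
  moreover have "even (c a * A $ a $ a * v $ a)" for a by (simp add: diag)
  ultimately have "even (\<Sum>a\<in>UNIV. \<Sum>b\<in>UNIV. c a * A $ a $ b * v $ b)"
    by (intro sum_symmetric_even) auto
  moreover have "form v v = e i * (\<Sum>a\<in>UNIV. \<Sum>b\<in>UNIV. c a * A $ a $ b * v $ b)"
    by (simp add: form_def term_eq sum_distrib_left)
  ultimately show ?thesis by (simp add: mult.commute)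
qed

text \<open>Split \<open>\<beta> = p - q\<close> into positive and negative parts. Both have norm divisible by the norm of
  \<open>\<beta>\<close>, and the norm of \<open>\<beta>\<close> is at least the sum of theirs, so one of them vanishes.\<close>

lemma root_like_sign_coherent:
  assumes "root_like \<beta>"
  shows "nonneg_vec \<beta> \<or> nonneg_vec (- \<beta>)"
proof (rule ccontr)
  assume neg: "\<not> ?thesis"
  obtain i where i: "form \<beta> \<beta> = 2 * e i" "\<And>j. e i dvd e j * \<beta> $ j"
    using assms by (auto simp: root_like_def)
  define p q :: "int^'n" where "p = (\<chi> j. max (\<beta> $ j) 0)" and "q = (\<chi> j. max (- \<beta> $ j) 0)"
  have \<beta>: "\<beta> = p - q" by (auto simp: p_def q_def vec_eq_iff max_def)
  have "p \<noteq> 0" "q \<noteq> 0"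
    using neg by (auto simp: p_def q_def vec_eq_iff nonneg_vec_def max_def not_le split: if_splits)
  then have pos: "form p p > 0" "form q q > 0" by (auto intro: form_pos)
  have "e i dvd e j * p $ j" "e i dvd e j * q $ j" for j
    using i(2)[of j] by (auto simp: p_def q_def max_def)
  then have "2 * e i dvd form p p" "2 * e i dvd form q q"
    by (auto intro: form_dvd)
  then have ge: "form p p \<ge> 2 * e i" "form q q \<ge> 2 * e i"
    using pos by (auto intro: zdvd_imp_le)
  have "form p q \<le> 0"
    unfolding form_def
  proof (intro sum_nonpos)
    fix a b
    show "e a * A $ a $ b * p $ a * q $ b \<le> 0"
    proof (cases "a = b")
      case True
      then show ?thesis by (simp add: p_def q_def max_def)
    next
      case False
      then have "e a * A $ a $ b \<le> 0"
        using e_pos[of a] off_diag[of a b] by (simp add: mult_le_0_iff)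
      moreover have "p $ a * q $ b \<ge> 0" by (simp add: p_def q_def)
      ultimately have "(e a * A $ a $ b) * (p $ a * q $ b) \<le> 0" by (rule mult_nonpos_nonneg)
      then show ?thesis by (simp add: mult.assoc)
    qed
  qed
  moreover have "form \<beta> \<beta> = form p p + form q q - 2 * form p q"
    by (simp add: \<beta> form_diff_left form_diff_right form_sym[of q p])
  ultimately show False using i(1) ge e_pos[of i] by linarith
qed

text \<open>On vertices of one sign the form is diagonal, and it is a sum of nonnegative multiples of
  the norm \<open>2 e\<^sub>i\<close> of \<open>\<beta>\<close>, so exactly one coefficient survives.\<close>

lemma root_like_one_sign:
  assumes "root_like \<beta>" and "nonneg_vec \<beta>" and supp: "\<And>j. \<epsilon> j \<noteq> t \<Longrightarrow> \<beta> $ j = 0"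
  obtains k where "\<epsilon> k = t" and "\<beta> = simple_root k"
proof -
  obtain i where i: "form \<beta> \<beta> = 2 * e i" "\<And>j. e i dvd e j * \<beta> $ j"
    using assms(1) by (auto simp: root_like_def)
  obtain c where c: "\<And>j. e j * \<beta> $ j = e i * c j"
    using i(2) unfolding dvd_def by metis
  have "form \<beta> \<beta> = (\<Sum>a\<in>UNIV. \<Sum>b\<in>UNIV. if b = a then 2 * e i * (c a * \<beta> $ a) else 0)"
    unfolding form_def
  proof (intro sum.cong refl)
    fix a b
    have "A $ a $ b * \<beta> $ a * \<beta> $ b = 0" if "a \<noteq> b"
      using same_sign[OF that] supp[of a] supp[of b] by (cases "\<epsilon> a = t"; cases "\<epsilon> b = t") auto
    moreover have "e a * 2 * \<beta> $ a * \<beta> $ a = 2 * e i * (c a * \<beta> $ a)"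
      using c[of a] by (simp add: algebra_simps)
    ultimately show "e a * A $ a $ b * \<beta> $ a * \<beta> $ b = (if b = a then 2 * e i * (c a * \<beta> $ a) else 0)"
      by (auto simp: diag mult.assoc)
  qed
  also have "\<dots> = 2 * e i * (\<Sum>a\<in>UNIV. c a * \<beta> $ a)"
    by (simp add: sum_distrib_left)
  finally have one: "(\<Sum>a\<in>UNIV. c a * \<beta> $ a) = 1"
    using i(1) e_pos[of i] by simp
  have cnn: "c a \<ge> 0" for a
  proof -
    have "e i * c a \<ge> 0"
      using assms(2) e_pos[of a] by (simp add: c[symmetric] nonneg_vec_def)
    then show ?thesis using e_pos[of i] by (simp add: zero_le_mult_iff)
  qed
  have nn: "c a * \<beta> $ a \<ge> 0" for a
    using cnn[of a] assms(2) by (simp add: nonneg_vec_def)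
  obtain k where k: "c k * \<beta> $ k \<noteq> 0"
    using one by (metis sum.neutral zero_neq_one)
  have sum_k: "c k * \<beta> $ k + (\<Sum>a\<in>UNIV - {k}. c a * \<beta> $ a) = 1"
    using one by (simp add: sum.remove[of UNIV k])
  moreover have "(\<Sum>a\<in>UNIV - {k}. c a * \<beta> $ a) \<ge> 0" by (intro sum_nonneg nn)
  moreover have "c k * \<beta> $ k > 0"
    using nn[of k] k by (metis order_le_less)
  ultimately have k1: "c k * \<beta> $ k = 1" and rest: "(\<Sum>a\<in>UNIV - {k}. c a * \<beta> $ a) = 0"
    by linarith+
  have "\<beta> $ k = 1"
    using k1 assms(2) by (metis nonneg_vec_def zmult_eq_1_iff neg_0_le_iff_le not_one_le_zero)
  moreover have "\<beta> $ a = 0" if "a \<noteq> k" for a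
  proof -
    have "c a * \<beta> $ a = 0"
      using rest that nn by (simp add: sum_nonneg_eq_0_iff)
    then have "c a = 0 \<or> \<beta> $ a = 0" by simp
    then show ?thesis using c[of a] e_pos[of a] by auto
  qed
  ultimately have "\<beta> = simple_root k"
    by (auto simp: vec_eq_iff simple_root_nth)
  moreover have "\<epsilon> k = t" using supp[of k] \<open>\<beta> $ k = 1\<close> by auto
  ultimately show ?thesis using that by blast
qed


section \<open>The two halves of the Coxeter element\<close>

text \<open>The product of the commuting simple reflections at the vertices of sign \<open>t\<close>.\<close>

definition act :: "int \<Rightarrow> int^'n \<Rightarrow> int^'n" where
  "act t \<alpha> = (\<chi> i. if \<epsilon> i = t then - (\<alpha> $ i) - (\<Sum>j\<in>UNIV - {i}. A $ i $ j * \<alpha> $ j) else \<alpha> $ i)"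

lemma act_nth:
  "act t \<alpha> $ i = (if \<epsilon> i = t then - (\<alpha> $ i) - (\<Sum>j\<in>UNIV - {i}. A $ i $ j * \<alpha> $ j) else \<alpha> $ i)"
  by (simp add: act_def)

lemma act_add: "act t (u + v) = act t u + act t v"
  by (simp add: vec_eq_iff act_nth distrib_left sum.distrib)

lemma act_scale: "act t (c *s u) = c *s act t u"
  by (simp add: vec_eq_iff act_nth sum_distrib_left right_diff_distrib mult_ac)

lemma act_sum: "act t (\<Sum>a\<in>S. f a) = (\<Sum>a\<in>S. act t (f a))"
proof (induction S rule: infinite_finite_induct)
  case (insert a S)
  then show ?case by (simp add: act_add)
qed (simp_all add: vec_eq_iff act_nth)

lemma sum_other_sign:
  assumes "\<epsilon> i = t"
  shows "(\<Sum>j\<in>UNIV - {i}. A $ i $ j * act t \<alpha> $ j) = (\<Sum>j\<in>UNIV - {i}. A $ i $ j * \<alpha> $ j)"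
proof (rule sum.cong)
  fix j assume "j \<in> UNIV - {i}"
  then show "A $ i $ j * act t \<alpha> $ j = A $ i $ j * \<alpha> $ j"
    using assms same_sign[of i j] by (cases "\<epsilon> j = t") (auto simp: act_nth)
qed simp

lemma act_act: "act t (act t \<alpha>) = \<alpha>"
  by (simp add: vec_eq_iff act_nth[of t "act t \<alpha>"] sum_other_sign) (simp add: act_nth)

lemma act_roots:
  assumes "\<alpha> \<in> roots A"
  shows "act t \<alpha> \<in> roots A"
proof -
  define part where "part S = (\<chi> i. if i \<in> S then act t \<alpha> $ i else \<alpha> $ i)" for S
  have "part S \<in> roots A" if "S \<subseteq> {i. \<epsilon> i = t}" for S
    using finite[of S] that
  proof (induction S rule: finite_induct)
    case empty
    have "part {} = \<alpha>" by (simp add: part_def vec_eq_iff)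
    then show ?case using assms by simp
  next
    case (insert k S)
    have "(\<Sum>l\<in>UNIV - {k}. A $ k $ l * part S $ l) = (\<Sum>l\<in>UNIV - {k}. A $ k $ l * \<alpha> $ l)"
    proof (rule sum.cong)
      fix l assume "l \<in> UNIV - {k}"
      then show "A $ k $ l * part S $ l = A $ k $ l * \<alpha> $ l"
        using insert.prems same_sign[of k l] by (cases "l \<in> S") (auto simp: part_def)
    qed simp
    then have "(\<Sum>l\<in>UNIV. A $ k $ l * part S $ l) = 2 * \<alpha> $ k + (\<Sum>l\<in>UNIV - {k}. A $ k $ l * \<alpha> $ l)"
      using insert.hyps by (simp add: sum.remove[of UNIV k] diag) (simp add: part_def)
    then have "simple_reflection A k (part S) = part (insert k S)"
      using insert.hyps insert.prems
      by (auto simp: simple_reflection_eq vec_eq_iff simple_root_nth) (auto simp: part_def act_nth)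
    then show ?case
      using roots.reflect[OF insert.IH, of k] insert.prems by simp
  qed
  from this[of "{i. \<epsilon> i = t}"] have "part {i. \<epsilon> i = t} \<in> roots A" by simp
  moreover have "part {i. \<epsilon> i = t} = act t \<alpha>" by (simp add: part_def vec_eq_iff act_nth)
  ultimately show ?thesis by simp
qed

lemma act_simple_root:
  "act t (simple_root k) $ i = (if \<epsilon> i = t then if i = k then -1 else - A $ i $ k else if i = k then 1 else 0)"
proof -
  have "(\<Sum>j\<in>UNIV - {i}. A $ i $ j * simple_root k $ j) = (\<Sum>j\<in>UNIV - {i}. if j = k then A $ i $ k else 0)"
    by (rule sum.cong) (auto simp: simple_root_nth)
  then show ?thesis by (auto simp: act_nth simple_root_nth)
qed

lemma act_simple_same: "\<epsilon> k = t \<Longrightarrow> act t (simple_root k) = - simple_root k"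
  using same_sign[of _ k] by (auto simp: vec_eq_iff act_simple_root simple_root_nth)

lemma act_minus: "act t (- u) = - act t u"
  by (simp add: vec_eq_iff act_nth sum_negf)

text \<open>Only coordinates at vertices of sign \<open>t\<close> change, so by sign coherence the others were zero.\<close>

lemma act_leaves_cone:
  assumes \<alpha>: "\<alpha> \<in> roots A" "nonneg_vec \<alpha>" and "\<not> nonneg_vec (act t \<alpha>)"
  obtains k where "\<epsilon> k = t" and "\<alpha> = simple_root k"
proof -
  have "nonneg_vec (- act t \<alpha>)"
    using root_like_sign_coherent[OF root_like_roots[OF act_roots[OF \<alpha>(1)]]] assms(3) by blast
  then have "\<alpha> $ j = 0" if "\<epsilon> j \<noteq> t" for j
    using that \<alpha>(2) unfolding nonneg_vec_def by (metis act_nth neg_0_le_iff_le order_antisym vector_uminus_component)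
  then show ?thesis
    by (rule root_like_one_sign[OF root_like_roots[OF \<alpha>(1)] \<alpha>(2)]) (use that in blast)+
qed

text \<open>Each half of the Coxeter element only moves the coordinates of its own sign, so a vector fixed
  by the product is fixed by both halves, hence orthogonal to all simple roots.\<close>

lemma act_fixed_zero:
  assumes t: "t = 1 \<or> t = -1" and fixed: "act (- t) (act t u) = u"
  shows "u = 0"
proof (rule ccontr)
  assume "u \<noteq> 0"
  have eq: "act t u = act (- t) u"
    using fixed act_act[of "- t" "act t u"] by simp
  have "(\<Sum>l\<in>UNIV. A $ i $ l * u $ l) = 0" for i
  proof -
    have ne: "t \<noteq> - t" using t by auto
    have "\<epsilon> i = t \<or> \<epsilon> i = - t" using t signs[of i] by auto
    then have "- (u $ i) - (\<Sum>j\<in>UNIV - {i}. A $ i $ j * u $ j) = u $ i"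
      using arg_cong[OF eq, of "\<lambda>v. v $ i"] ne by (auto simp: act_nth split: if_splits)
    then show ?thesis by (simp add: sum.remove[of UNIV i] diag)
  qed
  then have "(\<Sum>i\<in>UNIV. e i * u $ i * (\<Sum>j\<in>UNIV. A $ i $ j * u $ j)) = 0" by simp
  then have "form u u = 0" by (simp add: form_def sum_distrib_left mult_ac)
  then show False using form_pos[OF \<open>u \<noteq> 0\<close>] by simp
qed

primrec walk :: "int \<Rightarrow> int^'n \<Rightarrow> nat \<Rightarrow> int^'n" where
  "walk s \<alpha> 0 = \<alpha>"
| "walk s \<alpha> (Suc m) = walk (- s) (act s \<alpha>) m"

lemma walk_Suc: "walk s \<alpha> (Suc m) = act (s * (-1) ^ m) (walk s \<alpha> m)"
proof (induction m arbitrary: s \<alpha>)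
  case (Suc m)
  have "walk s \<alpha> (Suc (Suc m)) = walk (- s) (act s \<alpha>) (Suc m)" by simp
  also have "\<dots> = act (- s * (-1) ^ m) (walk (- s) (act s \<alpha>) m)" by (rule Suc.IH)
  finally show ?case by simp
qed simp

text \<open>If it never did, the orbit of \<open>\<alpha>\<close> under the Coxeter element would be a finite set of nonnegative
  roots, and the sum over a period would be a nonzero fixed vector.\<close>

lemma walk_leaves_cone:
  assumes s: "s = 1 \<or> s = -1" and \<alpha>: "\<alpha> \<in> roots A"
  obtains m where "\<not> nonneg_vec (walk s \<alpha> m)"
proof (rule ccontr)
  assume "\<not> thesis"
  with that have nonneg: "nonneg_vec (walk s \<alpha> m)" for m by blast
  define c where "c u = act (- s) (act s u)" for u
  have walk2: "walk s \<beta> (2 * m) = (c ^^ m) \<beta>" for m \<beta>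
    by (induction m arbitrary: \<beta>) (simp_all add: c_def funpow_swap1)
  have c_roots: "(c ^^ m) \<alpha> \<in> roots A" for m
    by (induction m) (simp_all add: \<alpha> c_def act_roots)
  have c_nonneg: "nonneg_vec ((c ^^ m) \<alpha>)" for m
    using nonneg[of "2 * m"] walk2[of \<alpha> m] by simp
  have "range (\<lambda>m. (c ^^ m) \<alpha>) \<subseteq> positive_roots A"
    using c_roots c_nonneg by (auto simp: positive_roots_def nonneg_vec_def)
  then have "\<not> inj (\<lambda>m. (c ^^ m) \<alpha>)"
    using finite_roots finite_imageD finite_subset infinite_UNIV_nat by blast
  then obtain a b where ab: "a < b" "(c ^^ a) \<alpha> = (c ^^ b) \<alpha>"
    unfolding inj_def by (metis linorder_less_linear)
  define u where "u = (\<Sum>m\<in>{a..<b}. (c ^^ m) \<alpha>)"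
  have "c u = (\<Sum>m\<in>{a..<b}. (c ^^ Suc m) \<alpha>)"
    by (simp add: u_def c_def act_sum)
  also have "\<dots> = (\<Sum>m\<in>{Suc a..<Suc b}. (c ^^ m) \<alpha>)"
    by (rule sum.shift_bounds_Suc_ivl[symmetric])
  also have "\<dots> = u"
    using ab by (simp add: u_def sum.atLeast_Suc_lessThan[of a b] add.commute)
  finally have "u = 0"
    unfolding c_def by (rule act_fixed_zero[OF s])
  have "(c ^^ a) \<alpha> $ j = 0" for j
  proof -
    have "(c ^^ a) \<alpha> $ j \<le> (\<Sum>m\<in>{a..<b}. (c ^^ m) \<alpha> $ j)"
      using ab(1) c_nonneg by (intro member_le_sum) (auto simp: nonneg_vec_def)
    also have "\<dots> = u $ j" by (simp add: u_def)
    finally show ?thesis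
      using c_nonneg[of a] \<open>u = 0\<close> by (auto simp: nonneg_vec_def intro: order_antisym)
  qed
  then have "(c ^^ a) \<alpha> = 0" by (simp add: vec_eq_iff)
  with root_like_nonzero[OF root_like_roots[OF c_roots[of a]]] show False by simp
qed

text \<open>The orbit of \<open>-\<alpha>\<^sub>k\<close> under the two halves in turn, starting with the half that contains \<open>k\<close>.
  The map is linear, so a chain describes the piecewise-linear orbit only until it leaves the
  nonnegative cone.\<close>

primrec chain :: "'n \<Rightarrow> nat \<Rightarrow> int^'n" where
  "chain k 0 = - simple_root k"
| "chain k (Suc r) = act (\<epsilon> k * (-1) ^ r) (chain k r)"

lemma chain_1: "chain k (Suc 0) = simple_root k"
  by (simp add: act_minus act_simple_same)

lemma chain_roots: "chain k r \<in> roots A"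
proof (induction r)
  case 0
  have "act (\<epsilon> k) (simple_root k) \<in> roots A" by (intro act_roots roots.simple)
  then show ?case by (simp add: act_simple_same)
qed (simp add: act_roots)

lemma chain_walk: "chain k (Suc m) = walk (- \<epsilon> k) (simple_root k) m"
proof (induction m)
  case 0
  show ?case using chain_1[of k] by simp
next
  case (Suc m)
  show ?case
    unfolding walk_Suc Suc[symmetric] by simp
qed

text \<open>The tropical form of the exchange relations along the belt. The case \<open>r = 0\<close> is the formula
  for \<open>act\<close> on \<open>\<alpha>\<^sub>k\<close>; the general case follows by applying the same word of halves to both sides, since
  a neighbour of \<open>k\<close> has the opposite sign and its chain is one step behind.\<close>

lemma chain_recurrence:
  "chain k (Suc (Suc r)) + chain k r = (\<Sum>j\<in>UNIV - {k}. (- A $ j $ k) *s chain j (Suc r))"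
proof (induction r)
  case 0
  have ne: "\<epsilon> k \<noteq> - \<epsilon> k" using signs[of k] by auto
  have "act (- \<epsilon> k) (simple_root k) $ i - simple_root k $ i
      = (\<Sum>j\<in>UNIV - {k}. - A $ j $ k * simple_root j $ i)" for i
  proof -
    have "(\<Sum>j\<in>UNIV - {k}. - A $ j $ k * simple_root j $ i)
        = (\<Sum>j\<in>UNIV - {k}. if j = i then - A $ i $ k else 0)"
      by (rule sum.cong) (auto simp: simple_root_nth)
    also have "\<dots> = (if i = k then 0 else - A $ i $ k)" by auto
    also have "\<dots> = act (- \<epsilon> k) (simple_root k) $ i - simple_root k $ i"
      using ne same_sign[of i k] signs[of i] signs[of k]
      by (auto simp: act_simple_root simple_root_nth)
    finally show ?thesis by simp
  qed
  then show ?case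
    using chain_1 by (simp add: vec_eq_iff del: chain.simps(2)) (simp add: act_minus act_simple_same)
next
  case (Suc r)
  let ?t = "\<epsilon> k * (-1) ^ Suc (Suc r)"
  have "chain k (Suc (Suc (Suc r))) + chain k (Suc r) = act ?t (chain k (Suc (Suc r)) + chain k r)"
    unfolding act_add by simp
  also have "\<dots> = (\<Sum>j\<in>UNIV - {k}. (- A $ j $ k) *s act ?t (chain j (Suc r)))"
    unfolding Suc act_sum act_scale ..
  also have "\<dots> = (\<Sum>j\<in>UNIV - {k}. (- A $ j $ k) *s chain j (Suc (Suc r)))"
  proof (rule sum.cong)
    fix j assume j: "j \<in> UNIV - {k}"
    have "A $ j $ k = 0 \<or> \<epsilon> j = - \<epsilon> k"
      using j same_sign[of j k] signs[of j] signs[of k] by auto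
    then show "(- A $ j $ k) *s act ?t (chain j (Suc r)) = (- A $ j $ k) *s chain j (Suc (Suc r))"
      by (auto simp: vec_eq_iff)
  qed simp
  finally show ?case .
qed

text \<open>The first step at which some chain leaves the cone; for all \<open>k\<close> it will turn out to be the
  same.\<close>

definition height :: nat where
  "height = (LEAST r. r \<ge> 1 \<and> (\<exists>k. \<not> nonneg_vec (chain k r)))"

lemma height_exists: "height \<ge> 1 \<and> (\<exists>k. \<not> nonneg_vec (chain k height))"
proof -
  fix k :: 'n
  obtain m where "\<not> nonneg_vec (walk (- \<epsilon> k) (simple_root k) m)"
    using walk_leaves_cone[of "- \<epsilon> k" "simple_root k"] signs[of k] roots.simple by fastforce
  then have "Suc m \<ge> 1 \<and> (\<exists>k. \<not> nonneg_vec (chain k (Suc m)))"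
    unfolding chain_walk by auto
  then show ?thesis unfolding height_def by (rule LeastI)
qed

lemma chain_nonneg: "1 \<le> r \<Longrightarrow> r < height \<Longrightarrow> nonneg_vec (chain k r)"
  using not_less_Least[of r "\<lambda>r. r \<ge> 1 \<and> (\<exists>k. \<not> nonneg_vec (chain k r))"]
  by (auto simp: height_def)

lemma simple_root_nonneg: "nonneg_vec (simple_root k)"
  by (simp add: nonneg_vec_def simple_root_nth)

lemma height_ge_2: "height \<ge> 2"
proof (rule ccontr)
  assume "\<not> ?thesis"
  then have "height = Suc 0" using height_exists by linarith
  then show False
    using height_exists chain_1 simple_root_nonneg by metis
qed

text \<open>If the chain at \<open>k\<close> leaves the cone at step \<open>height\<close>, its last root is simple, say
  \<open>\<alpha>\<^sub>l\<close>, and by the recurrence the chains at the neighbours of \<open>k\<close> have reached roots supported on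
  the vertices of the other sign, hence simple roots, so they leave the cone too.\<close>

lemma chain_height: "\<not> nonneg_vec (chain k height)"
proof -
  obtain M where M: "height = Suc (Suc M)"
    using height_ge_2 by (metis Suc_le_D numeral_2_eq_2 Suc_le_mono)
  define S where "S = {k. \<not> nonneg_vec (chain k height)}"
  have nonneg: "nonneg_vec (chain j (Suc M))" for j
    by (rule chain_nonneg) (simp_all add: M)
  have step: "j \<in> S" if k: "k \<in> S" and Ajk: "A $ j $ k \<noteq> 0" for j k
  proof (cases "j = k")
    case False
    define t where "t = \<epsilon> k * (-1) ^ Suc M"
    have t: "t = 1 \<or> t = -1" using signs[of k] by (auto simp: t_def minus_one_power_iff)
    have last: "chain k height = act t (chain k (Suc M))" "chain k (Suc M) = act (- t) (chain k M)"
      by (simp_all add: M t_def)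
    obtain l where l: "\<epsilon> l = t" "chain k (Suc M) = simple_root l"
      using act_leaves_cone[OF chain_roots nonneg, of t k] k last by (auto simp: S_def)
    have prev: "chain k M = act (- t) (simple_root l)"
      using last(2) l(2) act_act by metis
    have sign_j: "\<epsilon> j = - \<epsilon> k"
      using Ajk False same_sign[of j k] signs[of j] signs[of k] by auto
    have "chain j (Suc M) $ i = 0" if i: "\<epsilon> i \<noteq> - t" for i
    proof -
      define F where "F j = - A $ j $ k * chain j (Suc M) $ i" for j
      \<comment> \<open>On vertices of sign \<open>t\<close> the two vectors are \<open>-\<alpha>\<^sub>l\<close> and \<open>\<alpha>\<^sub>l\<close>.\<close>
      have "(chain k height + chain k M) $ i = 0"
        using i l t signs[of i] same_sign[of i l]
        unfolding last(1) l(2) prev by (auto simp: act_simple_same act_simple_root simple_root_nth)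
      then have "(\<Sum>j\<in>UNIV - {k}. F j) = 0"
        unfolding M chain_recurrence sum_component vector_smult_component F_def .
      moreover have "F j \<ge> 0" if "j \<in> UNIV - {k}" for j
        using off_diag[of j k] nonneg[of j] that by (simp add: F_def nonneg_vec_def mult_nonpos_nonneg del: chain.simps)
      ultimately have "\<forall>a\<in>UNIV - {k}. F a = 0"
        by (intro iffD1[OF sum_nonneg_eq_0_iff]) simp_all
      then have "F j = 0" using False by simp
      then have "A $ j $ k * chain j (Suc M) $ i = 0"
        by (simp add: F_def del: chain.simps)
      then show ?thesis using Ajk unfolding mult_eq_0_iff by blast
    qed
    then obtain m where m: "\<epsilon> m = - t" "chain j (Suc M) = simple_root m"
      using root_like_one_sign[OF root_like_roots[OF chain_roots] nonneg] by metis
    have "chain j height = act (- t) (chain j (Suc M))"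
      by (simp add: M t_def sign_j)
    then have "chain j height $ m = -1"
      using m by (simp add: act_simple_same simple_root_nth)
    then show ?thesis by (auto simp: S_def nonneg_vec_def intro!: exI[of _ m])
  qed (use k in simp)
  have "S \<noteq> {}" using height_exists by (auto simp: S_def)
  then have "S = UNIV" using step by (rule connected)
  then show ?thesis by (auto simp: S_def)
qed

text \<open>Walk from \<open>\<alpha>\<close> until a simple root is about to become negative, and read the walk
  backwards.\<close>

lemma positive_root_in_chain:
  assumes s: "s = 1 \<or> s = -1" and \<alpha>: "\<alpha> \<in> positive_roots A"
  obtains k r where "\<alpha> = chain k (Suc r)" and "\<epsilon> k * (-1) ^ r = s" and "Suc r < height"
proof -
  have reached: "\<exists>k r. \<alpha> = chain k (Suc r) \<and> \<epsilon> k * (-1) ^ r = s \<and> (\<forall>q\<le>r. nonneg_vec (chain k (Suc q)))"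
    if "\<not> nonneg_vec (walk s \<alpha> m)" "\<alpha> \<in> roots A" "nonneg_vec \<alpha>" for m \<alpha> s
    using that
  proof (induction m arbitrary: \<alpha> s)
    case (Suc m)
    show ?case
    proof (cases "nonneg_vec (act s \<alpha>)")
      case True
      then obtain k r where IH: "act s \<alpha> = chain k (Suc r)" "\<epsilon> k * (-1) ^ r = - s"
          "\<forall>q\<le>r. nonneg_vec (chain k (Suc q))"
        using Suc.IH[of "- s" "act s \<alpha>"] Suc.prems act_roots by auto
      have sign: "\<epsilon> k * (-1) ^ Suc r = s" using IH(2) by simp
      have "\<alpha> = chain k (Suc (Suc r))"
        using act_act[of s \<alpha>] unfolding chain.simps(2)[of k "Suc r"] IH(1)[symmetric] sign by simp
      moreover have "\<forall>q\<le>Suc r. nonneg_vec (chain k (Suc q))"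
        using IH(3) Suc.prems(3) calculation by (metis le_Suc_eq)
      ultimately show ?thesis using sign by blast
    next
      case False
      obtain k where k: "\<epsilon> k = s" "\<alpha> = simple_root k"
        using act_leaves_cone[OF Suc.prems(2,3) False] by blast
      then show ?thesis
        using chain_1[of k] simple_root_nonneg[of k] by (intro exI[of _ k] exI[of _ 0]) auto
    qed
  qed simp
  have \<alpha>': "\<alpha> \<in> roots A" "nonneg_vec \<alpha>"
    using \<alpha> by (auto simp: positive_roots_def nonneg_vec_def)
  obtain m where "\<not> nonneg_vec (walk s \<alpha> m)"
    using walk_leaves_cone[OF s \<alpha>'(1)] .
  from reached[OF this \<alpha>'] obtain k r where kr: "\<alpha> = chain k (Suc r)" "\<epsilon> k * (-1) ^ r = s"
      "\<forall>q\<le>r. nonneg_vec (chain k (Suc q))"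
    by blast
  have "Suc r < height"
  proof (rule ccontr)
    assume "\<not> ?thesis"
    then obtain q where "height = Suc q" "q \<le> r"
      using height_exists by (cases height) auto
    then show False using kr(3) chain_height[of k] by metis
  qed
  with kr show ?thesis using that by blast
qed

end


section \<open>The flips act on cluster variables as the piecewise-linear maps on roots\<close>

locale bipartite_finite_type =
  bipartite_seed x w B \<epsilon> d + bipartite_cartan "cartan_counterpart B" \<epsilon> e
  for x :: "'n::finite \<Rightarrow> 'f::field_char_0" and w B \<epsilon> d e
begin

text \<open>The alternating product of \<open>r\<close> flips whose innermost factor is the flip at \<open>t\<close>.\<close>

primrec flips :: "int \<Rightarrow> nat \<Rightarrow> 'f \<Rightarrow> 'f" where
  "flips t 0 z = z"
| "flips t (Suc r) z = flips (- t) r (flip t z)"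

lemma flips_outer: "flips t (Suc r) z = flip (t * (-1) ^ r) (flips t r z)"
proof (induction r arbitrary: t z)
  case (Suc r)
  have "flips t (Suc (Suc r)) z = flips (- t) (Suc r) (flip t z)" by simp
  also have "\<dots> = flip (- t * (-1) ^ r) (flips (- t) r (flip t z))" by (rule Suc.IH)
  finally show ?case by simp
qed simp

lemma flips_hom: "field_hom (flips t r)"
proof (induction r arbitrary: t)
  case 0
  show ?case by (simp add: field_hom_def)
next
  case (Suc r)
  have eq: "flips t (Suc r) = flips (- t) r \<circ> flip t" by (simp add: fun_eq_iff)
  show ?case unfolding eq by (rule field_hom_comp[OF Suc flip_hom])
qed

lemma flips_cluster_variable:
  "z \<in> cluster_variables (x, B) \<Longrightarrow> t \<in> {1, -1} \<Longrightarrow> flips t r z \<in> cluster_variables (x, B)"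
proof (induction r arbitrary: t z)
  case (Suc r)
  show ?case
    using Suc.IH[of "flip t z" "- t"] flip_cluster_variables[OF Suc.prems(2,1)] Suc.prems(2) by auto
qed simp

lemma sign_in: "\<epsilon> k \<in> {1, -1}"
  using signs[of k] by auto

lemma x_cluster_variable: "x k \<in> cluster_variables (x, B)"
  unfolding cluster_variables_iff
  using mutation_class_labeled[OF mutation_class.initial] by force

lemma flip_other_sign: "\<epsilon> k \<noteq> t \<Longrightarrow> flip t (x k) = x k"
  by (simp add: flip_var belt_def)

lemma cartan_off_diag: "j \<noteq> k \<Longrightarrow> - cartan_counterpart B $ j $ k = \<bar>B $ j $ k\<bar>"
  by (simp add: cartan_counterpart_def)

text \<open>The numerator of the exchange relation is \<open>1 + M\<close>. At the first step \<open>1\<close> dominates. From the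
  second step on, as long as the chains stay in the nonnegative cone, \<open>M\<close> has a nonpositive exponent and dominates, so the exchange relation turns
  into the linear recurrence of the chains.\<close>

lemma initial_exponent_flips:
  "r \<le> height \<Longrightarrow> has_initial_exponent (flips (\<epsilon> k) r (x k)) (- chain k r)"
proof (induction r arbitrary: k rule: less_induct)
  case (less r)
  consider "r = 0" | "r = Suc 0" | m where "r = Suc (Suc m)"
    by (metis not0_implies_Suc)
  then show ?case
  proof cases
    case 1
    then show ?thesis by (simp add: initial_exponent_var)
  next
    case 2
    have "has_initial_exponent (belt (\<epsilon> k) x k) (0 - simple_root k)"
      unfolding belt_def
      by (simp only: simp_thms if_True)
        (intro initial_exponent_divide initial_exponent_exchange_numerator initial_exponent_var)
    then show ?thesis
      unfolding 2 chain_1 by (simp add: flip_var)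
  next
    case 3
    define t where "t = \<epsilon> k"
    define h where "h = flips (- t) (Suc m)"
    define T where "T = {j. B $ j $ k \<noteq> 0}"
    define V where "V = (\<Sum>j\<in>UNIV - {k}. (- cartan_counterpart B $ j $ k) *s chain j (Suc m))"
    have h: "field_hom h" unfolding h_def by (rule flips_hom)
    have kT: "k \<notin> T" using B_same_sign[of k k] by (simp add: T_def)
    have sign: "\<epsilon> j = - t" if "j \<in> T" for j
      using that B_same_sign[of j k] signs[of j] signs[of k] by (auto simp: T_def t_def)
    have "has_initial_exponent (h (x j)) (- chain j (Suc m))" if "j \<in> T" for j
      using less.IH[of "Suc m" j] less.prems by (simp add: 3 h_def sign[OF that])
    then have "has_initial_exponent (\<Prod>j\<in>T. h (x j) ^ nat \<bar>B $ j $ k\<bar>)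
        (\<Sum>j\<in>T. int (nat \<bar>B $ j $ k\<bar>) *s - chain j (Suc m))"
      by (rule initial_exponent_prod)
    moreover have "(\<Prod>j\<in>T. h (x j) ^ nat \<bar>B $ j $ k\<bar>) = (\<Prod>j\<in>UNIV. h (x j) ^ nat \<bar>B $ j $ k\<bar>)"
      by (rule prod.mono_neutral_left) (auto simp: T_def)
    moreover have "(\<Sum>j\<in>T. int (nat \<bar>B $ j $ k\<bar>) *s - chain j (Suc m)) = - V"
    proof -
      have "V = (\<Sum>j\<in>T. (- cartan_counterpart B $ j $ k) *s chain j (Suc m))"
        unfolding V_def
        by (rule sum.mono_neutral_right) (use kT cartan_off_diag in \<open>auto simp: T_def\<close>)
      also have "\<dots> = (\<Sum>j\<in>T. int (nat \<bar>B $ j $ k\<bar>) *s chain j (Suc m))"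
      proof (rule sum.cong)
        fix j assume "j \<in> T"
        with kT have "j \<noteq> k" by auto
        then show "(- cartan_counterpart B $ j $ k) *s chain j (Suc m) = int (nat \<bar>B $ j $ k\<bar>) *s chain j (Suc m)"
          by (simp add: cartan_off_diag)
      qed simp
      finally show ?thesis
        by (simp add: vec_eq_iff sum_negf)
    qed
    ultimately have M: "has_initial_exponent (\<Prod>j\<in>UNIV. h (x j) ^ nat \<bar>B $ j $ k\<bar>) (- V)"
      by simp
    have "nonneg_vec (chain j (Suc m))" for j
      by (rule chain_nonneg) (use less.prems 3 in auto)
    then have "V $ i \<ge> 0" for i
      unfolding V_def sum_component
      by (intro sum_nonneg) (auto simp: cartan_off_diag nonneg_vec_def)
    then have "weight V \<ge> 0" by (rule weight_nonneg)
    then have "weight (- V) \<le> weight 0"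
      using weight_diff[of 0 V] by (simp add: weight_0)
    from initial_exponent_add[OF M initial_exponent_1 this]
    have num: "has_initial_exponent (1 + (\<Prod>j\<in>UNIV. h (x j) ^ nat \<bar>B $ j $ k\<bar>)) (- V)"
      by (simp add: add.commute)
    have "\<epsilon> k \<noteq> - t" using signs[of k] by (auto simp: t_def)
    then have "h (x k) = flips t m (x k)"
      by (simp add: h_def flip_other_sign)
    then have den: "has_initial_exponent (h (x k)) (- chain k m)"
      using less.IH[of m k] less.prems by (simp add: 3 t_def)
    have "flips (\<epsilon> k) r (x k) = h (belt t x k)"
      by (simp add: 3 h_def t_def flip_var)
    also have "\<dots> = (1 + (\<Prod>j\<in>UNIV. h (x j) ^ nat \<bar>B $ j $ k\<bar>)) / h (x k)"
      by (simp add: belt_def t_def field_hom_divide[OF h] field_hom_add[OF h] field_hom_1[OF h]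
          field_hom_prod[OF h] field_hom_power[OF h])
    finally have eq: "flips (\<epsilon> k) r (x k) = (1 + (\<Prod>j\<in>UNIV. h (x j) ^ nat \<bar>B $ j $ k\<bar>)) / h (x k)" .
    have "- V - - chain k m = - chain k r"
      using chain_recurrence[of k m] unfolding 3 V_def by (simp add: algebra_simps del: chain.simps)
    with initial_exponent_divide[OF num den] show ?thesis
      unfolding eq by simp
  qed
qed

lemma tau_nonneg:
  assumes "nonneg_vec \<alpha>"
  shows "tau (cartan_counterpart B) \<epsilon> s \<alpha> = act s \<alpha>"
proof -
  have pos: "max (\<alpha> $ j) 0 = \<alpha> $ j" for j
    using assms by (simp add: nonneg_vec_def)
  show ?thesis unfolding tau_def act_def pos ..
qed

lemma tau_minus_simple_root:
  "tau (cartan_counterpart B) \<epsilon> s (- simple_root i) = (if \<epsilon> i = s then simple_root i else - simple_root i)"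
proof -
  have "max ((- simple_root i :: int^'n) $ j) 0 = 0" for j by (simp add: simple_root_nth)
  then show ?thesis by (auto simp: tau_def vec_eq_iff simp del: vector_uminus_component)
      (auto simp: simple_root_nth)
qed

text \<open>Every positive root sits in a chain whose next step is the one at \<open>s\<close>, and the
  corresponding product of flips sends an initial variable to \<open>x\<^sub>\<alpha>\<close>.\<close>

lemma flip_denominator_bijection:
  assumes X: "denominator_bijection (x, B) X" and s: "s \<in> {1, -1}"
    and \<alpha>: "\<alpha> \<in> almost_positive_roots (cartan_counterpart B)"
  shows "flip s (X \<alpha>) = X (tau (cartan_counterpart B) \<epsilon> s \<alpha>)"
proof -
  have flips_X: "flips (\<epsilon> k) r (x k) = X (chain k r)" if "r \<le> height" for k r
    using cluster_variable_of_exponent[OF X flips_cluster_variable[OF x_cluster_variable sign_in]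
        initial_exponent_flips[OF that]] .
  show ?thesis
  proof (cases "\<alpha> \<in> positive_roots (cartan_counterpart B)")
    case True
    obtain k r where k: "\<alpha> = chain k (Suc r)" "\<epsilon> k * (-1) ^ r = - s" "Suc r < height"
      using positive_root_in_chain[of "- s" \<alpha>] s True by auto
    have sign: "\<epsilon> k * (-1) ^ Suc r = s" using k(2) by simp
    have "flip s (X \<alpha>) = flip s (flips (\<epsilon> k) (Suc r) (x k))"
      using flips_X[of "Suc r" k] k by simp
    also have "\<dots> = flips (\<epsilon> k) (Suc (Suc r)) (x k)"
      unfolding flips_outer[of "\<epsilon> k" "Suc r"] sign ..
    also have "\<dots> = X (chain k (Suc (Suc r)))"
      by (rule flips_X) (use k in simp)
    also have "chain k (Suc (Suc r)) = act s \<alpha>"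
      unfolding chain.simps(2)[of k "Suc r"] sign k(1) ..
    also have "act s \<alpha> = tau (cartan_counterpart B) \<epsilon> s \<alpha>"
      using True by (simp add: tau_nonneg positive_roots_def nonneg_vec_def)
    finally show ?thesis .
  next
    case False
    then obtain i where i: "\<alpha> = - simple_root i"
      using \<alpha> by (auto simp: almost_positive_roots_def)
    have Xi: "X \<alpha> = x i"
      using X by (simp add: denominator_bijection_def i)
    show ?thesis
    proof (cases "\<epsilon> i = s")
      case True
      have "flips (\<epsilon> i) (Suc 0) (x i) = X (chain i (Suc 0))"
        by (rule flips_X) (use height_ge_2 in simp)
      then have "flip s (x i) = X (simple_root i)"
        unfolding chain_1 using True by simp
      then show ?thesis
        unfolding Xi unfolding i tau_minus_simple_root using True by simp
    next
      case False
      then show ?thesis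
        unfolding Xi unfolding i tau_minus_simple_root using Xi flip_other_sign i by simp
    qed
  qed
qed

end


section \<open>Inverse cluster automorphisms from the piecewise-linear maps\<close>

theorem theorem3p1:
  fixes x :: "'n::finite \<Rightarrow> 'f::field_char_0"
    and B :: "int^'n^'n"
    and \<epsilon> :: "'n \<Rightarrow> int"
    and X :: "int^'n \<Rightarrow> 'f"
  assumes "labeled_seed (x, B)"
    and "finite_type (x, B)"
    and "CARD('n) > 1"
    and "indecomposable B"
    and "bipartite_with \<epsilon> B"
    and "cartan_matrix_of_finite_type (cartan_counterpart B)"
    and "denominator_bijection (x, B) X"
  shows "\<forall>s\<in>{1, -1}. \<exists>f.
    (\<forall>\<alpha> \<in> almost_positive_roots (cartan_counterpart B).
       f (X \<alpha>) = X (tau (cartan_counterpart B) \<epsilon> s \<alpha>)) \<and>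
    cluster_automorphism (x, B) f \<and>
    inverse_cluster_automorphism (x, B) f \<and>
    f \<circ> x \<in> ordered_clusters (x, B) \<and>
    exchange_matrix (x, B) (f \<circ> x) = - B"
proof -
  let ?A = "cartan_counterpart B"
  have free: "free_generating x"
    using assms(1) by (simp add: labeled_seed_def)
  obtain d where d: "\<And>i. d i > 0" "\<And>i j. d i * B $ i $ j = - (d j * B $ j $ i)"
    using assms(1) unfolding labeled_seed_def skew_symmetrizable_def snd_conv by blast
  obtain e where e: "\<And>i. e i > 0" "\<And>i j. e i * ?A $ i $ j = e j * ?A $ j $ i"
    and posdef: "\<And>v :: real^'n. v \<noteq> 0 \<Longrightarrow>
        (\<Sum>i\<in>UNIV. \<Sum>j\<in>UNIV. of_int (e i * ?A $ i $ j) * v $ i * v $ j) > 0"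
    using assms(6) unfolding cartan_matrix_of_finite_type_def by blast
  obtain w :: "'n \<Rightarrow> real" where w: "\<And>i. w i > 0"
    "\<And>v :: int^'n. (\<Sum>i\<in>UNIV. of_int (v $ i) * w i) = 0 \<Longrightarrow> v = 0"
    by (rule independent_weights_exist) (rule that)
  interpret bipartite_seed x w B \<epsilon> d
    by unfold_locales
      (rule free_generating_alg_independent[OF free] w free d assms(5) | assumption)+
  interpret bipartite_finite_type x w B \<epsilon> d e
  proof unfold_locales
    show "?A $ i $ i = 2" for i by (simp add: cartan_counterpart_def)
    show "?A $ i $ j \<le> 0" if "i \<noteq> j" for i j using that by (simp add: cartan_counterpart_def)
    show "(\<Sum>i\<in>UNIV. \<Sum>j\<in>UNIV. e i * ?A $ i $ j * v $ i * v $ j) > 0" if "v \<noteq> 0" for v :: "int^'n"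
    proof -
      have "(\<chi> i. real_of_int (v $ i)) \<noteq> 0"
        using that by (simp add: vec_eq_iff)
      from posdef[OF this]
      have "real_of_int (\<Sum>i\<in>UNIV. \<Sum>j\<in>UNIV. e i * ?A $ i $ j * v $ i * v $ j) > 0"
        by simp
      then show ?thesis by (simp only: of_int_0_less_iff)
    qed
    show "?A $ i $ j = 0" if "i \<noteq> j" "\<epsilon> i = \<epsilon> j" for i j
      using that B_same_sign by (simp add: cartan_counterpart_def)
    show "S = UNIV" if "S \<noteq> {}" and closed: "\<And>i j. i \<in> S \<Longrightarrow> ?A $ j $ i \<noteq> 0 \<Longrightarrow> j \<in> S" for S
    proof (rule ccontr)
      assume "S \<noteq> UNIV"
      then obtain i j where ij: "i \<in> S" "j \<notin> S" "B $ i $ j \<noteq> 0 \<or> B $ j $ i \<noteq> 0"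
        using assms(4) \<open>S \<noteq> {}\<close> unfolding indecomposable_def by blast
      then have "B $ j $ i \<noteq> 0"
        using d(2)[of i j] d(1)[of i] by auto
      then have "?A $ j $ i \<noteq> 0" by (simp add: cartan_counterpart_def)
      with closed ij show False by blast
    qed
    have "finite (almost_positive_roots ?A)"
      using assms(7) finite_cluster_variables[OF assms(2)] bij_betw_finite
      unfolding denominator_bijection_def by fastforce
    then show "finite (positive_roots ?A)"
      by (simp add: almost_positive_roots_def)
  qed (use e sign_cases in auto)
  show ?thesis
  proof
    fix s :: int assume s: "s \<in> {1, -1}"
    show "\<exists>f. (\<forall>\<alpha> \<in> almost_positive_roots ?A. f (X \<alpha>) = X (tau ?A \<epsilon> s \<alpha>)) \<and>
        cluster_automorphism (x, B) f \<and> inverse_cluster_automorphism (x, B) f \<and>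
        f \<circ> x \<in> ordered_clusters (x, B) \<and> exchange_matrix (x, B) (f \<circ> x) = - B"
      using flip_denominator_bijection[OF assms(7) s] flip_inverse_cluster_automorphism[OF assms(7) s]
        flip_ordered_cluster[OF s] exchange_matrix_flip[OF assms(7) s]
      by (intro exI[of _ "flip s"]) blast
  qed
qed

end
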